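(* The surface $S'=V(x^2y+y^2z+z^2t+t^2x)\subset P^3$ is, up to projective equivalence, the unique nonsingular cubic surface over $k$ whose automorphism group is isomorphic to the symmetric group $\mathbf{S}_5$. That is, $S'$ is nonsingular, $\mathrm{Aut}(S')\cong\mathbf{S}_5$, and every nonsingular cubic surface $V(f)\subset P^3$ over $k$ with $\mathrm{Aut}(V(f))\cong\mathbf{S}_5$ is projectively equivalent to $S'$.
   Context: $k$ is an algebraically closed field of characteristic zero, $PGL_4(k)=GL_4(k)/k^*E_4$ with $E_4$ the unit matrix, and $(A)$ denotes the class of $A\in GL_4(k)$ in $PGL_4(k)$. For a homogeneous polynomial $f$ in $x,y,z,t$ over $k$, $V(f)\subset P^3$ is its zero set; $V(f)$ is nonsingular if the partial derivatives of $f$ have no common zero on $V(f)$. For $A\in GL_4(k)$, $f_A(v)=f(A^{-1}v)$ for column vectors $v$ of variables, and $f_A\sim f$ means $f_A=\lambda f$ for some $\lambda\in k^*$. For a nonsingular cubic surface $V(f)$ (with $f$ homogeneous of degree 3), $\mathrm{Aut}(V(f))=\{(A)\in PGL_4(k): f_A\sim f\}$. Surfaces $V(f)$ and $V(g)$ are projectively equivalent if $g\sim f_A$ for some $A\in GL_4(k)$. *)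

theory Defs
  imports
    "HOL-Analysis.Cartesian_Space"
    "HOL-Algebra.Sym_Groups"
    "HOL-Computational_Algebra.Polynomial"
    "HOL-Library.Poly_Mapping"
begin

section \<open>Polynomials in the four variables x, y, z, t\<close>

text \<open>
  The index type of the variables is the same four-element type that indexes the entries
  of vectors and matrices; x, y, z, t correspond to the indices 1, 2, 3, 4.
  A monomial is its exponent vector, a polynomial a finitely supported family of
  coefficients, so that equality is equality of formal polynomials.
\<close>

type_synonym monomial4 = "4 \<Rightarrow>\<^sub>0 nat"
type_synonym 'k poly4 = "monomial4 \<Rightarrow>\<^sub>0 'k"

definition Const4 :: "'k \<Rightarrow> 'k::zero poly4" where
  "Const4 c = Poly_Mapping.single 0 c"

definition Var4 :: "4 \<Rightarrow> 'k::zero_neq_one poly4" where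
  "Var4 i = Poly_Mapping.single (Poly_Mapping.single i 1) 1"

definition homogeneous4 :: "nat \<Rightarrow> 'k::zero poly4 \<Rightarrow> bool" where
  "homogeneous4 d f \<longleftrightarrow>
     (\<forall>m \<in> Poly_Mapping.keys f. (\<Sum>i\<in>UNIV. Poly_Mapping.lookup m i) = d)"

text \<open>The element \<open>f(r\<^sub>1, r\<^sub>2, r\<^sub>3, r\<^sub>4)\<close> of a ring that receives the coefficients through \<open>h\<close>.\<close>

definition insert4 :: "('k::zero \<Rightarrow> 'r::comm_semiring_1) \<Rightarrow> 'r^4 \<Rightarrow> 'k poly4 \<Rightarrow> 'r" where
  "insert4 h r f = (\<Sum>m \<in> Poly_Mapping.keys f.
      h (Poly_Mapping.lookup f m) * (\<Prod>i\<in>UNIV. (r $ i) ^ Poly_Mapping.lookup m i))"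

definition eval4 :: "'k::comm_semiring_1 poly4 \<Rightarrow> 'k^4 \<Rightarrow> 'k" where
  "eval4 f v = insert4 (\<lambda>c. c) v f"

text \<open>The truncated subtraction of exponents is harmless: the coefficient vanishes when the
  exponent of the variable is zero.\<close>

definition pderiv4 :: "4 \<Rightarrow> 'k::comm_semiring_1 poly4 \<Rightarrow> 'k poly4" where
  "pderiv4 i f = (\<Sum>m \<in> Poly_Mapping.keys f.
      Poly_Mapping.single (m - Poly_Mapping.single i 1)
        (of_nat (Poly_Mapping.lookup m i) * Poly_Mapping.lookup f m))"

section \<open>Surfaces in projective 3-space\<close>

definition proportional4 :: "(('k::field^4) \<times> ('k^4)) set" where
  "proportional4 = {(v, w). v \<noteq> 0 \<and> w \<noteq> 0 \<and> (\<exists>c. c \<noteq> 0 \<and> w = c *s v)}"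

definition P3 :: "('k::field^4) set set" where
  "P3 = (UNIV - {0}) // proportional4"

text \<open>For homogeneous \<open>f\<close>, vanishing does not depend on the representative of the point.\<close>

definition zero_locus4 :: "'k::field poly4 \<Rightarrow> ('k^4) set set" where
  "zero_locus4 f = {P \<in> P3. \<forall>v\<in>P. eval4 f v = 0}"

definition nonsingular4 :: "'k::field poly4 \<Rightarrow> bool" where
  "nonsingular4 f \<longleftrightarrow> \<not> (\<exists>P \<in> zero_locus4 f. \<forall>i. \<forall>v\<in>P. eval4 (pderiv4 i f) v = 0)"

definition nonsingular_cubic :: "'k::field poly4 \<Rightarrow> bool" where
  "nonsingular_cubic f \<longleftrightarrow> homogeneous4 3 f \<and> nonsingular4 f"

section \<open>The projective linear group and automorphisms\<close>

definition GL4 :: "('k::field^4^4) monoid" where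
  "GL4 = \<lparr>carrier = {A. invertible A}, mult = (**), one = mat 1\<rparr>"

definition scalars4 :: "('k::field^4^4) set" where
  "scalars4 = {mat c | c. c \<noteq> 0}"

definition PGL4 :: "('k::field^4^4) set monoid" where
  "PGL4 = GL4 Mod scalars4"

definition PGL_class :: "'k::field^4^4 \<Rightarrow> ('k^4^4) set" where
  "PGL_class A = scalars4 #>\<^bsub>GL4\<^esub> A"

text \<open>The polynomial \<open>f\<^sub>A(v) = f(A\<^sup>-\<^sup>1 v)\<close> for the column vector \<open>v\<close> of the four variables.\<close>

definition act4 :: "'k::field^4^4 \<Rightarrow> 'k poly4 \<Rightarrow> 'k poly4" where
  "act4 A f = insert4 Const4 (map_matrix Const4 (matrix_inv A) *v (\<chi> i. Var4 i)) f"

definition sim4 :: "'k::field poly4 \<Rightarrow> 'k poly4 \<Rightarrow> bool"  (infix \<open>\<sim>\<^sub>4\<close> 50) where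
  "f \<sim>\<^sub>4 g \<longleftrightarrow> (\<exists>c. c \<noteq> 0 \<and> f = Const4 c * g)"

definition Aut :: "'k::field poly4 \<Rightarrow> ('k^4^4) set monoid" where
  "Aut f = PGL4 \<lparr>carrier := {PGL_class A | A. A \<in> carrier GL4 \<and> act4 A f \<sim>\<^sub>4 f}\<rparr>"

definition proj_equiv :: "'k::field poly4 \<Rightarrow> 'k poly4 \<Rightarrow> bool" where
  "proj_equiv f g \<longleftrightarrow> (\<exists>A \<in> carrier GL4. g \<sim>\<^sub>4 act4 A f)"

definition cubic_S' :: "'k::field poly4" where
  "cubic_S' = (let x = Var4 1; y = Var4 2; z = Var4 3; t = Var4 4
               in x^2 * y + y^2 * z + z^2 * t + t^2 * x)"

section \<open>Well-definedness of the quotient group\<close>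

lemma group_GL4: "group (GL4 :: ('k::field^4^4) monoid)"
proof (rule groupI)
  fix A :: "'k^4^4" assume "A \<in> carrier GL4"
  then obtain B where "A ** B = mat 1" "B ** A = mat 1"
    by (auto simp: GL4_def invertible_def)
  then show "\<exists>B \<in> carrier GL4. B \<otimes>\<^bsub>GL4\<^esub> A = \<one>\<^bsub>GL4\<^esub>"
    by (auto simp: GL4_def invertible_def)
next
  show "\<one>\<^bsub>GL4\<^esub> \<in> carrier (GL4 :: ('k::field^4^4) monoid)"
    by (auto simp: GL4_def invertible_def intro!: exI[of _ "mat 1"])
qed (auto simp: GL4_def invertible_mult matrix_mul_assoc)

lemma mat_mult_entry: "(mat c ** A) $ i $ j = c * (A :: 'k::field^4^4) $ i $ j"
  "(A ** mat c) $ i $ j = c * A $ i $ j"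
proof -
  have "(mat c ** A) $ i $ j = (\<Sum>l\<in>UNIV. if l = i then c * A $ l $ j else 0)"
    unfolding matrix_matrix_mult_def mat_def by (simp only: vec_lambda_beta, intro sum.cong) auto
  then show "(mat c ** A) $ i $ j = c * A $ i $ j" by simp
  have "(A ** mat c) $ i $ j = (\<Sum>l\<in>UNIV. if l = j then c * A $ i $ l else 0)"
    unfolding matrix_matrix_mult_def mat_def by (simp only: vec_lambda_beta, intro sum.cong) auto
  then show "(A ** mat c) $ i $ j = c * A $ i $ j" by simp
qed

lemma mat_commute: "mat c ** (A :: 'k::field^4^4) = A ** mat c"
  by (simp add: vec_eq_iff mat_mult_entry)

lemma mat_mult_mat: "mat c ** (mat d :: 'k::field^4^4) = mat (c * d)"
  unfolding vec_eq_iff mat_mult_entry by (simp add: mat_def)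

lemma normal_scalars4: "scalars4 \<lhd> (GL4 :: ('k::field^4^4) monoid)"
proof -
  interpret group "GL4 :: ('k^4^4) monoid" by (rule group_GL4)
  have inv: "mat (inverse c) ** (mat c :: 'k^4^4) = mat 1" "(mat c :: 'k^4^4) ** mat (inverse c) = mat 1"
    if "c \<noteq> 0" for c using that by (simp_all add: mat_mult_mat)
  have sub: "scalars4 \<subseteq> carrier (GL4 :: ('k^4^4) monoid)"
    using inv by (auto simp: scalars4_def GL4_def invertible_def)
  have "subgroup scalars4 (GL4 :: ('k^4^4) monoid)"
  proof (rule subgroupI[OF sub])
    show "scalars4 \<noteq> ({} :: ('k^4^4) set)" using zero_neq_one[where 'a='k] by (auto simp: scalars4_def intro!: exI[of _ "1::'k"])
  next
    fix a :: "'k^4^4" assume "a \<in> scalars4"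
    then obtain c where c: "a = mat c" "c \<noteq> 0" by (auto simp: scalars4_def)
    have s: "mat (inverse c) \<in> (scalars4 :: ('k^4^4) set)" using c(2) by (auto simp: scalars4_def)
    have "inv\<^bsub>GL4\<^esub> a = mat (inverse c)"
      using inv[OF c(2)] s sub \<open>a \<in> scalars4\<close> c(1)
      by (intro inv_equality) (auto simp: GL4_def)
    with s show "inv\<^bsub>GL4\<^esub> a \<in> scalars4" by simp
  next
    fix a b :: "'k^4^4" assume "a \<in> scalars4" "b \<in> scalars4"
    then show "a \<otimes>\<^bsub>GL4\<^esub> b \<in> scalars4"
      by (auto simp: scalars4_def GL4_def mat_mult_mat)
  qed
  then show ?thesis
    by (rule normalI)
      (auto simp: r_coset_def l_coset_def scalars4_def GL4_def mat_commute)
qed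

lemma group_PGL4: "group (PGL4 :: ('k::field^4^4) set monoid)"
  unfolding PGL4_def by (rule normal.factorgroup_is_group[OF normal_scalars4])

end

theory Submission
  imports Defs
begin

text \<open>
  If \<open>\<zeta>\<close> is a primitive fifth root of unity, the five linear forms
  \<open>\<zeta>\<^sup>i x + \<zeta>\<^sup>3\<^sup>i y + \<zeta>\<^sup>4\<^sup>i z + \<zeta>\<^sup>2\<^sup>i t\<close> sum to zero and their cubes sum to 15 times the equation of \<open>S'\<close>;
  so \<open>S'\<close> is the Clebsch diagonal cubic and \<open>S\<^sub>5\<close> acts by permuting these forms. There are no further
  automorphisms: the points whose polar quadric has rank at most 2 are the ten points dual to the pairs
  of forms, and a linear map that permutes these points and respects incidence permutes the five forms.

  Conversely, if the automorphism group of a nonsingular cubic contains an element of order 5, that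
  element is diagonalizable. Nonsingularity forces some monomial \<open>x\<^sub>i\<^sup>2 x\<^sub>j\<close> for each \<open>i\<close>, so after
  normalization every eigenvalue \<open>\<kappa>\<close> is accompanied by the eigenvalue \<open>\<kappa>\<^sup>3\<close>. Hence the eigenvalues are
  \<open>\<eta>, \<eta>\<^sup>3, \<eta>\<^sup>4, \<eta>\<^sup>2\<close>, only the four monomials of \<open>S'\<close> are invariant, and a diagonal change of
  coordinates makes their coefficients 1.
\<close>

section \<open>Evaluation of polynomials\<close>

text \<open>Coefficients outside the support vanish, so the support may be enlarged; a finite set
  common to two polynomials makes evaluation additive.\<close>

lemma insert4_superset:
  assumes "finite S" "Poly_Mapping.keys f \<subseteq> S" "h 0 = 0"
  shows "insert4 h r f = (\<Sum>m\<in>S. h (Poly_Mapping.lookup f m) * (\<Prod>i\<in>UNIV. (r $ i) ^ Poly_Mapping.lookup m i))"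
  unfolding insert4_def
  by (rule sum.mono_neutral_left) (use assms in \<open>auto simp: in_keys_iff\<close>)

lemma eval4_superset:
  assumes "finite S" "Poly_Mapping.keys f \<subseteq> S"
  shows "eval4 f v = (\<Sum>m\<in>S. Poly_Mapping.lookup f m * (\<Prod>i\<in>UNIV. (v $ i) ^ Poly_Mapping.lookup m i))"
  unfolding eval4_def by (rule insert4_superset) (use assms in auto)

lemma eval4_add: "eval4 (f + g) v = eval4 f v + eval4 g v"
  by (simp add: eval4_superset[of "Poly_Mapping.keys f \<union> Poly_Mapping.keys g"] Poly_Mapping.keys_add
      lookup_add distrib_right sum.distrib)

lemma eval4_zero [simp]: "eval4 0 v = 0"
  by (simp add: eval4_def insert4_def)

lemma eval4_sum: "eval4 (sum F S) v = (\<Sum>x\<in>S. eval4 (F x) v)"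
  by (induction S rule: infinite_finite_induct) (auto simp: eval4_add)

lemma eval4_single: "eval4 (Poly_Mapping.single m c) v = c * (\<Prod>i\<in>UNIV. (v $ i) ^ Poly_Mapping.lookup m i)"
  by (simp add: eval4_superset[of "{m}"])

lemma eval4_Const4 [simp]: "eval4 (Const4 c) v = c"
  by (simp add: Const4_def eval4_single)

lemma eval4_Var4 [simp]: "eval4 (Var4 i) v = v $ i"
proof -
  have "(\<Prod>j\<in>UNIV. (v $ j) ^ Poly_Mapping.lookup (Poly_Mapping.single i (1::nat)) j)
      = (\<Prod>j\<in>UNIV. if j = i then v $ j else 1)"
    by (intro prod.cong) (auto simp: lookup_single)
  then show ?thesis by (simp add: Var4_def eval4_single)
qed

lemma sum_single_keys: "f = (\<Sum>m\<in>Poly_Mapping.keys f. Poly_Mapping.single m (Poly_Mapping.lookup f m))"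
proof (rule poly_mapping_eqI)
  fix k
  have "(\<Sum>m\<in>Poly_Mapping.keys f. Poly_Mapping.lookup (Poly_Mapping.single m (Poly_Mapping.lookup f m)) k)
     = (\<Sum>m\<in>Poly_Mapping.keys f. if m = k then Poly_Mapping.lookup f m else 0)"
    by (intro sum.cong) (auto simp: lookup_single when_def)
  also have "\<dots> = Poly_Mapping.lookup f k"
    by (simp add: in_keys_iff)
  finally show "Poly_Mapping.lookup f k = Poly_Mapping.lookup (\<Sum>m\<in>Poly_Mapping.keys f. Poly_Mapping.single m (Poly_Mapping.lookup f m)) k"
    by (simp add: lookup_sum)
qed

text \<open>For single terms the exponents add; both factors are sums of single terms, and
  bilinearity does the rest.\<close>

lemma eval4_mult: "eval4 (f * g) v = eval4 f v * eval4 g v"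
proof -
  have s: "eval4 (Poly_Mapping.single m c * Poly_Mapping.single n d) v
      = eval4 (Poly_Mapping.single m c) v * eval4 (Poly_Mapping.single n d) v" for m n c d
    by (simp add: mult_single eval4_single lookup_add power_add prod.distrib ac_simps)
  have "f * g = (\<Sum>m\<in>Poly_Mapping.keys f. \<Sum>n\<in>Poly_Mapping.keys g.
      Poly_Mapping.single m (Poly_Mapping.lookup f m) * Poly_Mapping.single n (Poly_Mapping.lookup g n))"
    by (subst (1) sum_single_keys[of f], subst (1) sum_single_keys[of g]) (simp add: sum_product)
  then have "eval4 (f * g) v = (\<Sum>m\<in>Poly_Mapping.keys f. \<Sum>n\<in>Poly_Mapping.keys g.
      eval4 (Poly_Mapping.single m (Poly_Mapping.lookup f m)) v * eval4 (Poly_Mapping.single n (Poly_Mapping.lookup g n)) v)"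
    by (simp add: eval4_sum s)
  also have "\<dots> = eval4 f v * eval4 g v"
    by (subst (3) sum_single_keys[of f], subst (3) sum_single_keys[of g]) (simp add: eval4_sum sum_product)
  finally show ?thesis .
qed

lemma eval4_one [simp]: "eval4 1 v = 1"
  using eval4_Const4[of 1 v] by (simp add: Const4_def)

lemma eval4_power: "eval4 (f ^ n) v = eval4 f v ^ n"
  by (induction n) (auto simp: eval4_mult)

lemma eval4_prod: "eval4 (prod F S) v = (\<Prod>x\<in>S. eval4 (F x) v)"
  by (induction S rule: infinite_finite_induct) (auto simp: eval4_mult)

text \<open>Evaluation is a ring homomorphism, hence commutes with the linear substitution that
  defines the action.\<close>

lemma eval4_act4: "eval4 (act4 A f) v = eval4 f (matrix_inv A *v v)"
proof -
  have "eval4 ((map_matrix Const4 (matrix_inv A) *v (\<chi> i. Var4 i)) $ i) v = (matrix_inv A *v v) $ i" for i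
    by (simp add: matrix_vector_mult_def map_matrix_def eval4_sum eval4_mult)
  then show ?thesis
    unfolding act4_def by (simp add: insert4_def eval4_sum eval4_mult eval4_prod eval4_power)
      (simp add: eval4_def insert4_def)
qed

text \<open>Kronecker substitution: \<open>(s, s\<^sup>N, s\<^sup>N\<^sup>*\<^sup>N, \<dots>)\<close> separates monomials with exponents below \<open>N\<close>.\<close>

lemma eval4_inject:
  fixes f g :: "'k::field_char_0 poly4"
  assumes "\<And>v. eval4 f v = eval4 g v"
  shows "f = g"
proof -
  define S where "S = Poly_Mapping.keys f \<union> Poly_Mapping.keys g"
  have fin: "finite S" by (simp add: S_def)
  have "finite ((\<lambda>(m, i). Poly_Mapping.lookup m i) ` (S \<times> (UNIV :: 4 set)))"
    using fin by simp
  then obtain N where "\<forall>x\<in>(\<lambda>(m, i). Poly_Mapping.lookup m i) ` (S \<times> (UNIV :: 4 set)). x < N"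
    using finite_nat_set_iff_bounded by blast
  then have N: "Poly_Mapping.lookup m i < N" if "m \<in> S" for m i
    using that by force
  \<comment> \<open>With these exponents \<open>e m\<close> is the number whose
    base-\<open>N\<close> digits are the exponents of \<open>m\<close>, the exponent of the first
    variable being the lowest digit.\<close>
  define d :: "4 \<Rightarrow> nat" where "d i = (if i = 1 then 1 else if i = 2 then N else if i = 3 then N^2 else N^3)" for i
  define e where "e m = (\<Sum>i\<in>UNIV. d i * Poly_Mapping.lookup m i)" for m :: monomial4
  have dvals: "d 1 = 1" "d 2 = N" "d 3 = N * N" "d 4 = N * (N * N)"
    by (simp_all add: d_def power2_eq_square power3_eq_cube)
  have digit: "a = a' \<and> b = b'" if "a + N * b = a' + N * b'" "a < N" "a' < N" for a b a' b' :: nat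
  proof -
    have "a = a'" using arg_cong[OF that(1), of "\<lambda>x. x mod N"] that(2,3) by simp
    with that show ?thesis by simp
  qed
  have inj: "m = m'" if "e m = e m'" "m \<in> S" "m' \<in> S" for m m'
  proof -
    let ?a = "Poly_Mapping.lookup m" and ?b = "Poly_Mapping.lookup m'"
    have h: "e n = Poly_Mapping.lookup n 1 + N * (Poly_Mapping.lookup n 2 + N * (Poly_Mapping.lookup n 3 + N * Poly_Mapping.lookup n 4))" for n
      unfolding e_def sum_4 dvals by (simp add: algebra_simps)
    have "?a 1 = ?b 1" and r: "?a 2 + N * (?a 3 + N * ?a 4) = ?b 2 + N * (?b 3 + N * ?b 4)"
      using digit[OF that(1)[unfolded h]] N that by auto
    moreover have "?a 2 = ?b 2" and r2: "?a 3 + N * ?a 4 = ?b 3 + N * ?b 4"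
      using digit[OF r] N that by auto
    moreover have "?a 3 = ?b 3" "?a 4 = ?b 4"
      using digit[OF r2] N that by auto
    ultimately have "\<forall>i. ?a i = ?b i" by (simp add: forall_4)
    then show ?thesis by (simp add: poly_mapping_eqI)
  qed
  define p where "p h = (\<Sum>m\<in>S. monom (Poly_Mapping.lookup h m) (e m))" for h :: "'k poly4"
  have coeff: "coeff (p h) (e m) = Poly_Mapping.lookup h m" if "m \<in> S" for h m
  proof -
    have "coeff (p h) (e m) = (\<Sum>n\<in>S. if n = m then Poly_Mapping.lookup h n else 0)"
      unfolding p_def coeff_sum coeff_monom by (intro sum.cong) (use inj that in auto)
    then show ?thesis using that fin by simp
  qed
  have poly: "poly (p h) s = eval4 h (\<chi> i. s ^ d i)" if "Poly_Mapping.keys h \<subseteq> S" for h s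
    unfolding p_def poly_sum poly_monom eval4_superset[OF fin that] e_def
    by (simp add: power_sum power_mult)
  \<comment> \<open>A field of characteristic zero is infinite, so a univariate polynomial is
    determined by its values.\<close>
  have "poly (p f) = poly (p g)"
    using assms by (auto simp: poly S_def)
  then have "p f = p g" by (simp add: poly_eq_poly_eq_iff)
  then have "Poly_Mapping.lookup f m = Poly_Mapping.lookup g m" if "m \<in> S" for m
    using coeff that by metis
  moreover have "Poly_Mapping.lookup f m = Poly_Mapping.lookup g m" if "m \<notin> S" for m
    using that by (auto simp: S_def in_keys_iff)
  ultimately show ?thesis by (intro poly_mapping_eqI) blast
qed

section \<open>The polar form of a cubic\<close>

text \<open>Two adjacent transpositions generate all permutations of the arguments, so linearity in
  the first one carries over to the others.\<close>

locale symmetric_trilinear =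
  fixes T :: "'k::field_char_0^4 \<Rightarrow> 'k^4 \<Rightarrow> 'k^4 \<Rightarrow> 'k"
  assumes swap12: "T u v w = T v u w"
    and swap23: "T u v w = T u w v"
    and add_left: "T (u + u') v w = T u v w + T u' v w"
    and scale_left: "T (c *s u) v w = c * T u v w"
begin

lemma add_mid: "T u (v + v') w = T u v w + T u v' w"
  by (metis swap12 add_left)

lemma add_right: "T u v (w + w') = T u v w + T u v w'"
  by (metis swap23 add_mid)

lemma scale_mid: "T u (c *s v) w = c * T u v w"
  by (metis swap12 scale_left)

lemma scale_right: "T u v (c *s w) = c * T u v w"
  by (metis swap23 scale_mid)

lemma zero_left [simp]: "T 0 v w = 0"
  using scale_left[of 0 0 v w] by simp

lemma sum_left: "T (\<Sum>i\<in>S. c i *s b i) v w = (\<Sum>i\<in>S. c i * T (b i) v w)"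
  by (induction S rule: infinite_finite_induct) (auto simp: add_left scale_left)

lemma sum_mid: "T u (\<Sum>i\<in>S. c i *s b i) w = (\<Sum>i\<in>S. c i * T u (b i) w)"
  by (simp add: swap12[of u] sum_left)

lemma sum_right: "T u v (\<Sum>i\<in>S. c i *s b i) = (\<Sum>i\<in>S. c i * T u v (b i))"
  by (simp add: swap23[of u v] sum_mid)

text \<open>Inclusion-exclusion over the subsets of the three vectors: only terms containing each of
  \<open>u\<close>, \<open>v\<close>, \<open>w\<close> survive, and there are 3! of them.\<close>

lemma polarization:
  "6 * T u v w = T (u + v + w) (u + v + w) (u + v + w) - T (u + v) (u + v) (u + v)
     - T (u + w) (u + w) (u + w) - T (v + w) (v + w) (v + w) + T u u u + T v v v + T w w w"
proof -
  have "T u w v = T u v w" "T v u w = T u v w" "T v w u = T u v w" "T w u v = T u v w" "T w v u = T u v w"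
    by (metis swap12 swap23)+
  then show ?thesis
    by (simp add: add_left add_mid add_right algebra_simps)
qed

text \<open>By polarization the values on the diagonal determine the form, so invariance of a cubic
  up to a factor passes to its polar form.\<close>

lemma semi_invariant:
  assumes add: "\<And>u v. B (u + v) = B u + B v"
    and D: "\<And>v. T (B v) (B v) (B v) = c * T v v v"
  shows "T (B u) (B v) (B w) = c * T u v w"
proof -
  have "6 * T (B u) (B v) (B w) = 6 * (c * T u v w)"
    unfolding mult.left_commute[of 6 c] polarization add[symmetric] D by (simp add: algebra_simps)
  then show ?thesis by simp
qed

end

lemma symmetric_trilinear_eqI:
  assumes "symmetric_trilinear T" "symmetric_trilinear T'" "\<And>v. T v v v = T' v v v"
  shows "T = T'"
proof (intro ext)
  fix u v w
  have "6 * T u v w = 6 * T' u v w"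
    unfolding symmetric_trilinear.polarization[OF assms(1)] symmetric_trilinear.polarization[OF assms(2)] assms(3) ..
  then show "T u v w = T' u v w" by simp
qed

section \<open>Cubic monomials and their derivatives\<close>

abbreviation monom4_at :: "monomial4 \<Rightarrow> 'k::comm_semiring_1^4 \<Rightarrow> 'k" where
  "monom4_at m v \<equiv> (\<Prod>i\<in>UNIV. (v $ i) ^ Poly_Mapping.lookup m i)"

lemma monom4_at_add: "monom4_at (m + n) v = monom4_at m v * monom4_at n v"
  by (simp add: lookup_add power_add prod.distrib)

lemma monom4_at_single: "monom4_at (Poly_Mapping.single i 1) v = v $ i"
  using eval4_Var4[of i v] by (simp add: Var4_def eval4_single)

lemma monomial4_degree_Suc:
  fixes m :: monomial4
  assumes "(\<Sum>i\<in>UNIV. Poly_Mapping.lookup m i) = Suc n"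
  obtains i m' where "m = Poly_Mapping.single i 1 + m'" "(\<Sum>i\<in>UNIV. Poly_Mapping.lookup m' i) = n"
proof -
  obtain i where i: "Poly_Mapping.lookup m i > 0"
    using assms by (metis (no_types, lifting) Zero_not_Suc gr0I sum.neutral)
  define m' where "m' = m - Poly_Mapping.single i 1"
  have m: "m = Poly_Mapping.single i 1 + m'"
    by (rule poly_mapping_eqI)
      (use i in \<open>auto simp: m'_def lookup_add lookup_minus lookup_single when_def\<close>)
  have "Suc n = (\<Sum>j\<in>UNIV. if j = i then 1 else 0) + (\<Sum>i\<in>UNIV. Poly_Mapping.lookup m' i)"
    unfolding assms[symmetric] sum.distrib[symmetric]
    by (subst m, intro sum.cong) (auto simp: lookup_add lookup_single when_def)
  then show ?thesis by (intro that[OF m]) simp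
qed

text \<open>Splitting a cubic monomial into three variables permits an explicit polar form, summed
  over the orders of the factors.\<close>

lemma monomial4_degree_3:
  fixes m :: monomial4
  assumes "(\<Sum>i\<in>UNIV. Poly_Mapping.lookup m i) = 3"
  shows "\<exists>a b c. m = Poly_Mapping.single a 1 + Poly_Mapping.single b 1 + Poly_Mapping.single c 1"
proof -
  have "(\<Sum>i\<in>UNIV. Poly_Mapping.lookup m i) = Suc 2" using assms by simp
  then obtain a m1 where 1: "m = Poly_Mapping.single a 1 + m1" "(\<Sum>i\<in>UNIV. Poly_Mapping.lookup m1 i) = Suc 1"
    by (rule monomial4_degree_Suc) (use numeral_2_eq_2 in auto)
  obtain b m2 where 2: "m1 = Poly_Mapping.single b 1 + m2" "(\<Sum>i\<in>UNIV. Poly_Mapping.lookup m2 i) = Suc 0"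
    using 1(2) by (rule monomial4_degree_Suc) auto
  obtain c m3 where 3: "m2 = Poly_Mapping.single c 1 + m3" "(\<Sum>i\<in>UNIV. Poly_Mapping.lookup m3 i) = 0"
    using 2(2) by (rule monomial4_degree_Suc) auto
  have "m3 = 0" using 3(2) by (intro poly_mapping_eqI) simp
  with 1 2 3 show ?thesis by (auto simp: add.assoc)
qed

text \<open>Leibniz rule with one summand per factor; if the variable \<open>l\<close> occurs
  repeatedly, the coinciding summands add up to its multiplicity.\<close>

lemma monom4_at_derivative:
  assumes m: "m = Poly_Mapping.single a 1 + Poly_Mapping.single b 1 + Poly_Mapping.single c 1"
  shows "of_nat (Poly_Mapping.lookup m l) * monom4_at (m - Poly_Mapping.single l 1) v
    = (if a = l then v $ b * v $ c else 0) + (if b = l then v $ a * v $ c else 0)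
      + (if c = l then v $ a * v $ b else 0)"
proof -
  let ?e = "\<lambda>i. Poly_Mapping.single i 1 :: monomial4"
  have cancel: "?e l + n - ?e l = n" for n by (rule add_diff_cancel_left')
  have "a = l \<Longrightarrow> m - ?e l = ?e b + ?e c" "b = l \<Longrightarrow> m - ?e l = ?e a + ?e c" "c = l \<Longrightarrow> m - ?e l = ?e a + ?e b"
    using cancel[of "?e b + ?e c"] cancel[of "?e a + ?e c"] cancel[of "?e a + ?e b"]
    by (auto simp: m ac_simps)
  then have h: "a = l \<Longrightarrow> monom4_at (m - ?e l) v = v $ b * v $ c"
    "b = l \<Longrightarrow> monom4_at (m - ?e l) v = v $ a * v $ c"
    "c = l \<Longrightarrow> monom4_at (m - ?e l) v = v $ a * v $ b"
    by (simp_all only: monom4_at_add monom4_at_single)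
  have "of_nat (Poly_Mapping.lookup m l) = (if a = l then 1 else 0) + (if b = l then 1 else 0) + (if c = l then 1 else (0::'a))"
    by (auto simp: m lookup_add lookup_single when_def)
  then have "of_nat (Poly_Mapping.lookup m l) * monom4_at (m - ?e l) v =
     (if a = l then monom4_at (m - ?e l) v else 0) + (if b = l then monom4_at (m - ?e l) v else 0)
     + (if c = l then monom4_at (m - ?e l) v else 0)"
    by (simp only: distrib_right if_distrib[of "\<lambda>x. x * _"] mult_1_left mult_zero_left)
  also have "\<dots> = (if a = l then v $ b * v $ c else 0) + (if b = l then v $ a * v $ c else 0)
      + (if c = l then v $ a * v $ b else 0)"
    by (simp only: h cong: if_cong)
  finally show ?thesis .
qed

lemma eval4_pderiv4:
  "eval4 (pderiv4 l f) v = (\<Sum>m\<in>Poly_Mapping.keys f.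
     Poly_Mapping.lookup f m * (of_nat (Poly_Mapping.lookup m l) * monom4_at (m - Poly_Mapping.single l 1) v))"
  by (simp add: pderiv4_def eval4_sum eval4_single ac_simps)

lemma polar_form_exists:
  fixes f :: "'k::field_char_0 poly4"
  assumes "homogeneous4 3 f"
  obtains T where "symmetric_trilinear T" "\<And>v. T v v v = 6 * eval4 f v"
    "\<And>l v. T (axis l 1) v v = 2 * eval4 (pderiv4 l f) v"
proof -
  let ?e = "\<lambda>i. Poly_Mapping.single i 1 :: monomial4"
  have "\<forall>m\<in>Poly_Mapping.keys f. \<exists>x. m = ?e (fst x) + ?e (fst (snd x)) + ?e (snd (snd x))"
    using assms monomial4_degree_3 by (fastforce simp: homogeneous4_def)
  then obtain F where F: "\<forall>m\<in>Poly_Mapping.keys f. m = ?e (fst (F m)) + ?e (fst (snd (F m))) + ?e (snd (snd (F m)))"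
    by metis
  define a b c where "a m = fst (F m)" and "b m = fst (snd (F m))" and "c m = snd (snd (F m))" for m
  have abc: "m = ?e (a m) + ?e (b m) + ?e (c m)" if "m \<in> Poly_Mapping.keys f" for m
    using F that by (simp add: a_def b_def c_def)
  \<comment> \<open>Each monomial is symmetrized over all six assignments of \<open>u\<close>,
    \<open>v\<close>, \<open>w\<close> to its factors, without division by 6; this accounts for the
    constants 6 and 2 in the conclusion.\<close>
  define T where "T u v w = (\<Sum>m\<in>Poly_Mapping.keys f. Poly_Mapping.lookup f m *
     (u $ a m * (v $ b m * w $ c m + v $ c m * w $ b m) + u $ b m * (v $ a m * w $ c m + v $ c m * w $ a m)
      + u $ c m * (v $ a m * w $ b m + v $ b m * w $ a m)))" for u v w :: "'k^4"
  show ?thesis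
  proof (rule that[of T])
    show "symmetric_trilinear T"
    proof
      show "T u v w = T v u w" "T u v w = T u w v" for u v w
        unfolding T_def by (intro sum.cong refl; simp add: algebra_simps)+
      show "T (u + u') v w = T u v w + T u' v w" for u u' v w
        unfolding T_def sum.distrib[symmetric] by (intro sum.cong refl) (simp add: algebra_simps)
      show "T (s *s u) v w = s * T u v w" for s u v w
        unfolding T_def sum_distrib_left by (intro sum.cong refl) (simp add: algebra_simps)
    qed
  next
    fix v :: "'k^4"
    show "T v v v = 6 * eval4 f v"
      unfolding T_def eval4_def insert4_def sum_distrib_left
    proof (intro sum.cong refl, goal_cases)
      case (1 m)
      have "monom4_at m v = v $ a m * v $ b m * v $ c m"
        by (subst abc[OF 1]) (simp only: monom4_at_add monom4_at_single)
      then show ?case by (simp add: algebra_simps)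
    qed
  next
    fix l and v :: "'k^4"
    show "T (axis l 1) v v = 2 * eval4 (pderiv4 l f) v"
      unfolding T_def eval4_pderiv4 sum_distrib_left
      by (intro sum.cong refl) (subst monom4_at_derivative[OF abc], auto simp: axis_def algebra_simps)
  qed
qed

text \<open>The partial derivatives at \<open>v\<close> are, up to the factor 2, the coordinates of
  the linear form \<open>T u v v\<close> in \<open>u\<close>. Choosing \<open>u = v\<close> shows
  that their common zeros lie on the surface, which is Euler's relation.\<close>

lemma nonsingular_iff_polar_form:
  fixes f :: "'k::field_char_0 poly4"
  assumes T: "symmetric_trilinear T" "\<And>v. T v v v = 6 * eval4 f v"
    "\<And>l v. T (axis l 1) v v = 2 * eval4 (pderiv4 l f) v"
  shows "nonsingular4 f \<longleftrightarrow> (\<forall>v. (\<forall>u. T u v v = 0) \<longrightarrow> v = 0)"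
proof -
  interpret symmetric_trilinear T by fact
  show ?thesis
  proof
    assume ns: "nonsingular4 f"
    show "\<forall>v. (\<forall>u. T u v v = 0) \<longrightarrow> v = 0"
    proof (intro allI impI, rule ccontr)
      fix v :: "'k^4" assume v: "\<forall>u. T u v v = 0" "v \<noteq> 0"
      define P where "P = proportional4 `` {v}"
      have "P \<in> P3" using v(2) by (auto simp: P3_def P_def quotient_def)
      \<comment> \<open>Homogeneity transports the vanishing from \<open>v\<close> to every
        representative of the projective point.\<close>
      have "T u w w = 0" if "w \<in> P" for u w
        using that v(1) by (auto simp: P_def proportional4_def scale_mid scale_right)
      then have "eval4 f w = 0" "eval4 (pderiv4 i f) w = 0" if "w \<in> P" for i w
        using that T(2)[of w] T(3)[of i w] by auto
      then show False using ns \<open>P \<in> P3\<close> by (auto simp: nonsingular4_def zero_locus4_def)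
    qed
  next
    assume h: "\<forall>v. (\<forall>u. T u v v = 0) \<longrightarrow> v = 0"
    show "nonsingular4 f" unfolding nonsingular4_def
    proof safe
      fix P assume P: "P \<in> zero_locus4 f" "\<forall>i. \<forall>v\<in>P. eval4 (pderiv4 i f) v = 0"
      then obtain v where v: "v \<noteq> 0" "P = proportional4 `` {v}"
        by (auto simp: zero_locus4_def P3_def elim!: quotientE)
      then have v': "v \<in> P"
        by (auto simp: proportional4_def intro!: exI[of _ 1])
      have "T u v v = 0" for u
      proof -
        have "T (\<Sum>i\<in>UNIV. (u $ i) *s axis i 1) v v = 0"
          unfolding sum_left T(3) using P v' by simp
        then show ?thesis by (simp add: basis_expansion)
      qed
      with h v show False by blast
    qed
  qed
qed

section \<open>The Clebsch form of the cubic\<close>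

lemma eval4_cubic_S':
  "eval4 cubic_S' v = v$1 ^ 2 * v$2 + v$2 ^ 2 * v$3 + v$3 ^ 2 * v$4 + v$4 ^ 2 * v$1"
  by (simp add: cubic_S'_def Let_def eval4_add eval4_mult eval4_power)

lemma homogeneous4_add:
  "homogeneous4 d f \<Longrightarrow> homogeneous4 d g \<Longrightarrow> homogeneous4 d (f + g)"
  using Poly_Mapping.keys_add[of f g] by (auto simp: homogeneous4_def)

lemma homogeneous4_mult:
  assumes "homogeneous4 d f" "homogeneous4 e g"
  shows "homogeneous4 (d + e) (f * g)"
  unfolding homogeneous4_def
proof
  fix m assume "m \<in> Poly_Mapping.keys (f * g)"
  then obtain a b where "m = a + b" "a \<in> Poly_Mapping.keys f" "b \<in> Poly_Mapping.keys g"
    using keys_mult[of f g] by blast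
  then show "(\<Sum>i\<in>UNIV. Poly_Mapping.lookup m i) = d + e"
    using assms by (simp add: homogeneous4_def lookup_add sum.distrib)
qed

lemma homogeneous4_Var4: "homogeneous4 1 (Var4 i)"
  by (simp add: homogeneous4_def Var4_def lookup_single when_def)

lemma homogeneous4_cubic_S': "homogeneous4 3 (cubic_S' :: 'k::field poly4)"
proof -
  have "homogeneous4 3 (Var4 i * Var4 i * Var4 j :: 'k poly4)" for i j
    using homogeneous4_mult[OF homogeneous4_mult[OF homogeneous4_Var4 homogeneous4_Var4] homogeneous4_Var4, of i i j]
    by (simp add: numeral_3_eq_3)
  then show ?thesis
    by (simp add: cubic_S'_def Let_def power2_eq_square homogeneous4_add)
qed

text \<open>The fifth cyclotomic equation makes \<open>\<zeta>\<close> a primitive fifth root of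
  unity; the value 1 is excluded because 5 is nonzero in characteristic zero.\<close>

locale clebsch =
  fixes \<zeta> :: "'k::field_char_0"
  assumes cyclotomic: "1 + \<zeta> + \<zeta>^2 + \<zeta>^3 + \<zeta>^4 = 0"
begin

lemma zeta5: "\<zeta>^5 = 1"
proof -
  have "\<zeta>^5 - 1 = (\<zeta> - 1) * (1 + \<zeta> + \<zeta>^2 + \<zeta>^3 + \<zeta>^4)"
    by (simp add: algebra_simps power_numeral_reduce)
  then show ?thesis by (simp add: cyclotomic)
qed

lemma zeta_mod: "\<zeta>^n = \<zeta>^(n mod 5)"
proof -
  have "\<zeta>^n = \<zeta>^(5 * (n div 5) + n mod 5)" by simp
  also have "\<dots> = \<zeta>^(n mod 5)" by (simp only: power_add power_mult zeta5 power_one mult_1_left)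
  finally show ?thesis .
qed

lemma zeta_power_add: "\<zeta>^((m + n) * i) = \<zeta>^(m * i) * \<zeta>^(n * i)"
  by (simp add: add_mult_distrib power_add)

text \<open>If 5 does not divide \<open>n\<close>, multiplication by \<open>n\<close> permutes the
  nonzero residues modulo 5, and the sum is that of the four primitive roots.\<close>

lemma zeta_sum4: "\<zeta>^n + \<zeta>^(2*n) + \<zeta>^(3*n) + \<zeta>^(4*n) = (if 5 dvd n then 4 else - 1)"
proof -
  define m where "m = n mod 5"
  have r: "\<zeta>^(k*n) = \<zeta>^((k * m) mod 5)" for k
    by (subst zeta_mod) (simp add: m_def mod_mult_right_eq)
  have e: "\<zeta>^n + \<zeta>^(2*n) + \<zeta>^(3*n) + \<zeta>^(4*n) = \<zeta>^m + \<zeta>^((2*m) mod 5) + \<zeta>^((3*m) mod 5) + \<zeta>^((4*m) mod 5)"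
    by (simp only: r zeta_mod[of n] m_def)
  have c: "\<zeta>^4 = - 1 - \<zeta> - \<zeta>^2 - \<zeta>^3"
    using cyclotomic by (simp add: eq_diff_eq add_ac eq_neg_iff_add_eq_0)
  have "5 dvd n \<longleftrightarrow> m = 0" "m \<in> {0,1,2,3,4}" by (auto simp: m_def)
  then show ?thesis unfolding e by (auto simp: c)
qed

abbreviation I :: "nat set" where "I \<equiv> {1..5}"

lemma zeta_sum5: "(\<Sum>i\<in>I. \<zeta>^(n*i)) = (if 5 dvd n then 5 else 0)"
proof -
  have "I = {1,2,3,4,5}" by auto
  moreover have "\<zeta>^(n*5) = 1" by (subst mult.commute) (simp add: power_mult zeta5)
  ultimately have "(\<Sum>i\<in>I. \<zeta>^(n*i)) = \<zeta>^n + \<zeta>^(2*n) + \<zeta>^(3*n) + \<zeta>^(4*n) + 1"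
    by (simp add: algebra_simps)
  then show ?thesis by (simp add: zeta_sum4)
qed

text \<open>The weights with which \<open>diag(\<zeta>, \<zeta>\<^sup>3, \<zeta>\<^sup>4, \<zeta>\<^sup>2)\<close> leaves the four monomials of \<open>S'\<close> invariant.\<close>

definition wt :: "4 \<Rightarrow> nat" where
  "wt a = (if a = 1 then 1 else if a = 2 then 3 else if a = 3 then 4 else 2)"

lemma wt_simps: "wt 1 = 1" "wt 2 = 3" "wt 3 = 4" "wt 4 = 2"
  by (simp_all add: wt_def)

section \<open>The five linear forms and their dual vectors\<close>

definition ell :: "nat \<Rightarrow> 'k^4 \<Rightarrow> 'k" where
  "ell i v = (\<Sum>a\<in>UNIV. \<zeta>^(wt a * i) * v $ a)"

text \<open>Inverse Fourier transform of the five standard unit vectors. In the coordinates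
  \<open>ell\<close>, which sum to zero, \<open>r i\<close> is the \<open>i\<close>-th unit vector
  minus its mean 1/5.\<close>

definition r :: "nat \<Rightarrow> 'k^4" where
  "r i = (\<chi> a. \<zeta>^((5 - wt a) * i) / 5)"

lemma ell_add: "ell i (u + v) = ell i u + ell i v"
  by (simp add: ell_def sum.distrib algebra_simps)

lemma ell_scale: "ell i (c *s v) = c * ell i v"
  by (simp add: ell_def sum_distrib_left algebra_simps)

lemma ell_zero [simp]: "ell i 0 = 0"
  by (simp add: ell_def)

lemma ell_diff: "ell i (u - v) = ell i u - ell i v"
  by (simp add: ell_def sum_subtractf algebra_simps)

lemma ell_sum: "ell i (\<Sum>x\<in>S. F x) = (\<Sum>x\<in>S. ell i (F x))"
  by (induction S rule: infinite_finite_induct) (auto simp: ell_add)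

lemma ell_r:
  assumes "i \<in> I" "j \<in> I"
  shows "ell j (r i) = (if i = j then 1 else 0) - 1 / 5"
proof -
  \<comment> \<open>Modulo 5 this is \<open>j - i\<close>, written without subtraction of
    naturals.\<close>
  define n where "n = j + 4 * i"
  have "i \<in> {1,2,3,4,5}" "j \<in> {1,2,3,4,5}" using assms by auto
  then have n: "5 dvd n \<longleftrightarrow> i = j"
    by (auto simp: n_def)
  have e: "\<zeta>^(w * j) * \<zeta>^((5 - w) * i) = \<zeta>^(w * n)" if "w \<in> {1,2,3,4}" for w
  proof -
    have "w * n = w * j + (5 - w) * i + 5 * ((w - 1) * i)"
      using that by (auto simp: n_def)
    then show ?thesis by (simp only: power_add power_mult zeta5 power_one mult_1_right)
  qed
  have "ell j (r i) = (\<zeta>^n + \<zeta>^(2*n) + \<zeta>^(3*n) + \<zeta>^(4*n)) / 5"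
    unfolding ell_def r_def sum_4 wt_simps
    using e[of 1] e[of 2] e[of 3] e[of 4] by (simp add: add_divide_distrib wt_simps)
  then show ?thesis unfolding zeta_sum4 n by (auto simp: field_simps)
qed

text \<open>Finite Fourier inversion: the weights are distinct modulo 5, so the sum over
  \<open>i\<close> isolates the coordinate \<open>a\<close>.\<close>

lemma reconstruct: "v = (\<Sum>i\<in>I. ell i v *s r i)"
proof (subst vec_eq_iff, intro allI)
  fix a :: 4
  have d: "5 dvd wt b + (5 - wt a) \<longleftrightarrow> b = a" for b
    using exhaust_4[of a] exhaust_4[of b] by (elim disjE) (simp_all add: wt_simps del: One_nat_def)
  have "(\<Sum>i\<in>I. ell i v *s r i) $ a = (\<Sum>i\<in>I. \<Sum>b\<in>UNIV. \<zeta>^((wt b + (5 - wt a)) * i) * (v $ b / 5))"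
    unfolding sum_component vector_smult_component ell_def sum_distrib_right
    by (intro sum.cong refl) (simp add: zeta_power_add r_def)
  also have "\<dots> = (\<Sum>b\<in>UNIV. \<Sum>i\<in>I. \<zeta>^((wt b + (5 - wt a)) * i) * (v $ b / 5))"
    by (rule sum.swap)
  also have "\<dots> = (\<Sum>b\<in>UNIV. (if b = a then v $ b else 0))"
    unfolding sum_distrib_right[symmetric] zeta_sum5 d by (intro sum.cong) auto
  also have "\<dots> = v $ a" by simp
  finally show "v $ a = (\<Sum>i\<in>I. ell i v *s r i) $ a" by (rule sym)
qed

lemma ell_inject:
  assumes "\<And>i. i \<in> I \<Longrightarrow> ell i u = ell i v"
  shows "u = v"
proof -
  have "u = (\<Sum>i\<in>I. ell i u *s r i)" by (rule reconstruct)
  also have "\<dots> = (\<Sum>i\<in>I. ell i v *s r i)" using assms by (intro sum.cong) auto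
  also have "\<dots> = v" by (rule reconstruct[symmetric])
  finally show ?thesis .
qed

text \<open>No weight is divisible by 5, so every coefficient is a full sum over a nontrivial
  character.\<close>

lemma sum_ell: "(\<Sum>i\<in>I. ell i v) = 0"
proof -
  have d: "\<not> 5 dvd wt a" for a by (simp add: wt_def)
  have "(\<Sum>i\<in>I. ell i v) = (\<Sum>a\<in>UNIV. \<Sum>i\<in>I. \<zeta>^(wt a * i) * v $ a)"
    unfolding ell_def by (rule sum.swap)
  then show ?thesis
    unfolding sum_distrib_right[symmetric] zeta_sum5 using d by simp
qed

section \<open>The polar form in the five coordinates\<close>

definition \<tau> :: "'k^4 \<Rightarrow> 'k^4 \<Rightarrow> 'k^4 \<Rightarrow> 'k" where
  "\<tau> u v w = (\<Sum>i\<in>I. ell i u * ell i v * ell i w)"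

sublocale \<tau>: symmetric_trilinear \<tau>
proof
  show "\<tau> u v w = \<tau> v u w" "\<tau> u v w = \<tau> u w v" for u v w
    by (simp_all add: \<tau>_def ac_simps)
  show "\<tau> (u + u') v w = \<tau> u v w + \<tau> u' v w" for u u' v w
    by (simp add: \<tau>_def ell_add sum.distrib algebra_simps)
  show "\<tau> (c *s u) v w = c * \<tau> u v w" for c u v w
    by (simp add: \<tau>_def ell_scale sum_distrib_left algebra_simps)
qed

text \<open>The sum over \<open>i\<close> keeps the triples whose weights add up to a multiple of 5.
  Among the weights 1, 3, 4, 2 these are exactly the monomials of the equation, each in three orders
  and with factor 5, hence 15.\<close>

lemma \<tau>_diag: "\<tau> v v v = 15 * eval4 cubic_S' v"
proof -
  have "\<tau> v v v = (\<Sum>i\<in>I. \<Sum>a\<in>UNIV. \<Sum>b\<in>UNIV. \<Sum>c\<in>UNIV. \<zeta>^((wt a + wt b + wt c) * i) * (v $ a * v $ b * v $ c))"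
    unfolding \<tau>_def
  proof (intro sum.cong refl)
    fix i
    have sq: "ell i v * ell i v = (\<Sum>a\<in>UNIV. \<Sum>b\<in>UNIV. (\<zeta>^(wt a * i) * v $ a) * (\<zeta>^(wt b * i) * v $ b))"
      unfolding ell_def by (rule sum_product)
    have "ell i v * ell i v * ell i v = (\<Sum>a\<in>UNIV. \<Sum>b\<in>UNIV. \<Sum>c\<in>UNIV.
       (\<zeta>^(wt a * i) * v $ a) * (\<zeta>^(wt b * i) * v $ b) * (\<zeta>^(wt c * i) * v $ c))"
      unfolding sq sum_distrib_right unfolding ell_def sum_distrib_left ..
    then show "ell i v * ell i v * ell i v
      = (\<Sum>a\<in>UNIV. \<Sum>b\<in>UNIV. \<Sum>c\<in>UNIV. \<zeta>^((wt a + wt b + wt c) * i) * (v $ a * v $ b * v $ c))"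
      unfolding zeta_power_add by (simp only: ac_simps)
  qed
  also have "\<dots> = (\<Sum>a\<in>UNIV. \<Sum>b\<in>UNIV. \<Sum>c\<in>UNIV. \<Sum>i\<in>I. \<zeta>^((wt a + wt b + wt c) * i) * (v $ a * v $ b * v $ c))"
    by (subst sum.swap, intro sum.cong refl, subst sum.swap, intro sum.cong refl, subst sum.swap, rule refl)
  also have "\<dots> = 15 * eval4 cubic_S' v"
    unfolding sum_distrib_right[symmetric] zeta_sum5 eval4_cubic_S' sum_4 wt_simps
    by (simp add: power2_eq_square algebra_simps del: One_nat_def)
  finally show ?thesis .
qed

text \<open>The means 1/5 cancel, so in the coordinates \<open>ell\<close> this is a difference of
  two unit vectors, a convenient test vector.\<close>

definition dd :: "nat \<Rightarrow> nat \<Rightarrow> 'k^4" where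
  "dd i j = r i - r j"

lemma ell_dd:
  "i \<in> I \<Longrightarrow> j \<in> I \<Longrightarrow> k \<in> I \<Longrightarrow> ell k (dd i j) = (if k = i then 1 else 0) - (if k = j then 1 else 0)"
  by (auto simp: dd_def ell_diff ell_r)

text \<open>The forms \<open>ell i\<close> span the dual space and \<open>\<Sum>i. ell i = 0\<close> is their only relation.\<close>

lemma \<tau>_kernel:
  "(\<forall>w. \<tau> u v w = 0) \<longleftrightarrow> (\<forall>i\<in>I. \<forall>j\<in>I. ell i u * ell i v = ell j u * ell j v)"
proof
  assume h: "\<forall>w. \<tau> u v w = 0"
  show "\<forall>i\<in>I. \<forall>j\<in>I. ell i u * ell i v = ell j u * ell j v"
  proof (intro ballI)
    fix i j assume ij: "i \<in> I" "j \<in> I"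
    have "\<tau> u v (dd i j) = (\<Sum>k\<in>I. (if k = i then ell k u * ell k v else 0) - (if k = j then ell k u * ell k v else 0))"
      unfolding \<tau>_def by (intro sum.cong) (use ij in \<open>auto simp: ell_dd\<close>)
    also have "\<dots> = ell i u * ell i v - ell j u * ell j v"
      using ij by (simp add: sum_subtractf)
    finally show "ell i u * ell i v = ell j u * ell j v" using h by simp
  qed
next
  assume h: "\<forall>i\<in>I. \<forall>j\<in>I. ell i u * ell i v = ell j u * ell j v"
  show "\<forall>w. \<tau> u v w = 0"
  proof
    fix w
    have "\<tau> u v w = (\<Sum>i\<in>I. ell 1 u * ell 1 v * ell i w)"
      unfolding \<tau>_def
    proof (rule sum.cong)
      fix i assume "i \<in> I"
      moreover have "1 \<in> I" by simp
      ultimately have "ell i u * ell i v = ell 1 u * ell 1 v" using h by blast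
      then show "ell i u * ell i v * ell i w = ell 1 u * ell 1 v * ell i w" by simp
    qed simp
    then show "\<tau> u v w = 0" by (simp only: sum_distrib_left[symmetric] sum_ell mult_zero_right)
  qed
qed

lemma nonsingular_cubic_S': "nonsingular_cubic (cubic_S' :: 'k poly4)"
proof -
  obtain T where T: "symmetric_trilinear T" "\<And>v. T v v v = 6 * eval4 cubic_S' v"
    "\<And>l v. T (axis l 1) v v = 2 * eval4 (pderiv4 l cubic_S') (v :: 'k^4)"
    using polar_form_exists[OF homogeneous4_cubic_S'] by blast
  \<comment> \<open>On the diagonal \<open>T\<close> is 6 times and \<open>\<tau>\<close> is 15
    times the cubic, whence the ratio 2/5.\<close>
  have st: "symmetric_trilinear (\<lambda>u v w. 2 / 5 * \<tau> u v w)"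
  proof
    show "2 / 5 * \<tau> u v w = 2 / 5 * \<tau> v u w" "2 / 5 * \<tau> u v w = 2 / 5 * \<tau> u w v" for u v w
      by (simp_all add: \<tau>_def ac_simps)
  qed (simp_all add: \<tau>.add_left \<tau>.scale_left algebra_simps)
  have "T v v v = 2 / 5 * \<tau> v v v" for v by (simp add: T(2) \<tau>_diag)
  then have T': "T u v w = 2 / 5 * \<tau> u v w" for u v w
    using symmetric_trilinear_eqI[OF T(1) st] by simp
  have "v = 0" if h: "\<forall>u. T u v v = 0" for v
  proof -
    have "\<forall>u. \<tau> v v u = 0"
      using h by (simp add: T') (metis \<tau>.swap12 \<tau>.swap23)
    then have sq: "(ell i v)^2 = (ell 1 v)^2" if "i \<in> I" for i
    proof -
      have "1 \<in> I" by simp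
      then have "ell i v * ell i v = ell 1 v * ell 1 v"
        using \<open>\<forall>u. \<tau> v v u = 0\<close> that \<tau>_kernel[of v v] by blast
      then show ?thesis by (simp add: power2_eq_square)
    qed
    have pm: "ell i v = ell 1 v \<or> ell i v = - ell 1 v" if "i \<in> I" for i
      using sq[OF that] by (simp only: power2_eq_iff)
    \<comment> \<open>The five coordinates agree up to sign. Only the parity of the signs matters:
      five odd integers have an odd, hence nonzero sum, whereas the coordinates sum to zero.\<close>
    have "\<exists>\<alpha>::int. odd \<alpha> \<and> ell i v = of_int \<alpha> * ell 1 v" if "i \<in> I" for i
      using pm[OF that]
    proof
      assume "ell i v = ell 1 v"
      then show ?thesis by (intro exI[of _ 1]) simp
    next
      assume "ell i v = - ell 1 v"
      then show ?thesis by (intro exI[of _ "- 1"]) simp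
    qed
    then obtain \<alpha> :: "nat \<Rightarrow> int" where \<alpha>: "\<And>i. i \<in> I \<Longrightarrow> odd (\<alpha> i)" "\<And>i. i \<in> I \<Longrightarrow> ell i v = of_int (\<alpha> i) * ell 1 v"
      by metis
    have "odd (\<Sum>i\<in>I. \<alpha> i)"
    proof -
      have "{i \<in> I. odd (\<alpha> i)} = I" using \<alpha>(1) by blast
      then show ?thesis by (simp add: even_sum_iff)
    qed
    then have "of_int (\<Sum>i\<in>I. \<alpha> i) \<noteq> (0::'k)"
      by (metis even_zero of_int_eq_0_iff)
    moreover have "of_int (\<Sum>i\<in>I. \<alpha> i) * ell 1 v = (\<Sum>i\<in>I. ell i v)"
      unfolding of_int_sum sum_distrib_right by (intro sum.cong refl) (rule \<alpha>(2)[symmetric])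
    ultimately have "ell 1 v = 0"
      unfolding sum_ell by simp
    then have "ell i v = 0" if "i \<in> I" for i using pm[OF that] by auto
    then show ?thesis by (intro ell_inject) simp
  qed
  then show ?thesis
    unfolding nonsingular_cubic_def nonsingular_iff_polar_form[OF T] by (auto simp: homogeneous4_cubic_S')
qed

end

section \<open>Classes of matrices and automorphism groups\<close>

lemma mat_mult_vector: "mat c *v v = c *s (v :: 'k::field^4)"
proof (subst vec_eq_iff, intro allI)
  fix i
  have "(mat c *v v) $ i = (\<Sum>j\<in>UNIV. if j = i then c * v $ j else 0)"
    unfolding matrix_vector_mult_def mat_def by (simp only: vec_lambda_beta, intro sum.cong) auto
  then show "(mat c *v v) $ i = (c *s v) $ i" by simp
qed

lemma PGL_class_altdef: "PGL_class A = {mat c ** A | c. c \<noteq> 0}"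
  by (auto simp: PGL_class_def r_coset_def scalars4_def GL4_def)

lemma PGL_class_eq_iff: "PGL_class A = PGL_class B \<longleftrightarrow> (\<exists>c. c \<noteq> 0 \<and> A = mat c ** B)"
proof
  assume "PGL_class A = PGL_class B"
  moreover have "A \<in> PGL_class A"
    by (auto simp: PGL_class_altdef intro!: exI[of _ 1])
  ultimately show "\<exists>c. c \<noteq> 0 \<and> A = mat c ** B"
    by (auto simp: PGL_class_altdef)
next
  assume "\<exists>c. c \<noteq> 0 \<and> A = mat c ** B"
  then obtain c where c: "c \<noteq> 0" "A = mat c ** B" by blast
  have "mat d ** A = mat (d * c) ** B" "mat d ** B = mat (d / c) ** A" for d
    using c(1) by (simp_all add: c(2) matrix_mul_assoc mat_mult_mat)
  then show "PGL_class A = PGL_class B"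
    using c(1) by (fastforce simp: PGL_class_altdef)
qed

lemma PGL_class_mult:
  assumes "invertible A" "invertible B"
  shows "PGL_class A \<otimes>\<^bsub>PGL4\<^esub> PGL_class B = PGL_class (A ** B)"
  using normal.rcos_sum[OF normal_scalars4, of A B] assms
  by (simp add: PGL4_def FactGroup_def PGL_class_def GL4_def)

lemma matrix_inv_cancel:
  fixes A :: "'k::field^4^4"
  assumes "invertible A"
  shows "A *v (matrix_inv A *v v) = v" "matrix_inv A *v (A *v v) = v"
proof -
  have "A ** matrix_inv A = mat 1 \<and> matrix_inv A ** A = mat 1"
    using assms unfolding invertible_def matrix_inv_def by (rule someI_ex)
  then show "A *v (matrix_inv A *v v) = v" "matrix_inv A *v (A *v v) = v"
    by (simp_all add: matrix_vector_mul_assoc)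
qed

text \<open>Replacing \<open>v\<close> by \<open>A *v v\<close> removes the inverse from the action,
  and \<open>eval4_inject\<close> turns the pointwise identity into one of polynomials.\<close>

lemma act4_sim_iff:
  fixes f g :: "'k::field_char_0 poly4"
  assumes "invertible A"
  shows "act4 A f \<sim>\<^sub>4 g \<longleftrightarrow> (\<exists>c. c \<noteq> 0 \<and> (\<forall>v. eval4 f v = c * eval4 g (A *v v)))"
proof -
  have "act4 A f = Const4 c * g \<longleftrightarrow> (\<forall>v. eval4 f v = c * eval4 g (A *v v))" for c
  proof
    assume h: "act4 A f = Const4 c * g"
    show "\<forall>v. eval4 f v = c * eval4 g (A *v v)"
    proof
      fix v
      have "eval4 (act4 A f) (A *v v) = c * eval4 g (A *v v)" by (simp add: h eval4_mult)
      then show "eval4 f v = c * eval4 g (A *v v)" by (simp add: eval4_act4 matrix_inv_cancel[OF assms])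
    qed
  next
    assume "\<forall>v. eval4 f v = c * eval4 g (A *v v)"
    then show "act4 A f = Const4 c * g"
      by (intro eval4_inject) (simp add: eval4_mult eval4_act4 matrix_inv_cancel[OF assms])
  qed
  then show ?thesis by (simp add: sim4_def)
qed

lemma carrier_Aut:
  fixes f :: "'k::field_char_0 poly4"
  shows "carrier (Aut f) = {PGL_class A | A. invertible A \<and> (\<exists>c. c \<noteq> 0 \<and> (\<forall>v. eval4 f v = c * eval4 f (A *v v)))}"
  by (simp add: Aut_def GL4_def act4_sim_iff cong: conj_cong)

lemma mult_Aut: "x \<otimes>\<^bsub>Aut f\<^esub> y = x \<otimes>\<^bsub>PGL4\<^esub> y"
  by (simp add: Aut_def)

text \<open>Edges of a graph that meet pairwise form a star or a triangle, and a triangle has only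
  three edges.\<close>

lemma four_pairwise_intersecting_pairs:
  assumes "card A = 2" "card B = 2" "card C = 2" "card D = 2"
    and "A \<noteq> B" "A \<noteq> C" "A \<noteq> D" "B \<noteq> C" "B \<noteq> D" "C \<noteq> D"
    and "A \<inter> B \<noteq> {}" "A \<inter> C \<noteq> {}" "A \<inter> D \<noteq> {}" "B \<inter> C \<noteq> {}" "B \<inter> D \<noteq> {}" "C \<inter> D \<noteq> {}"
  shows "\<exists>b. b \<in> A \<and> b \<in> B \<and> b \<in> C \<and> b \<in> D"
proof -
  obtain b where b: "b \<in> A" "b \<in> B" using assms by blast
  have pair: "\<exists>y. X = {b, y} \<and> y \<noteq> b" if "card X = 2" "b \<in> X" for X
    using that by (auto simp: card_2_iff)
  obtain x y where x: "A = {b, x}" "x \<noteq> b" and y: "B = {b, y}" "y \<noteq> b"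
    using pair b assms(1,2) by meson
  have xy: "x \<noteq> y" using x y assms(5) by blast
  \<comment> \<open>An edge that avoids the common point \<open>b\<close> of \<open>A\<close> and
    \<open>B\<close> closes the triangle; by \<open>no\<close>, it then meets no further edge
    through \<open>b\<close>.\<close>
  have third: "X = {x, y}" if "card X = 2" "b \<notin> X" "A \<inter> X \<noteq> {}" "B \<inter> X \<noteq> {}" for X
  proof -
    have "{x, y} \<subseteq> X" using that x y by blast
    moreover have "finite X" using that(1) by (simp add: card_ge_0_finite)
    ultimately show ?thesis using that(1) xy by (intro card_subset_eq[symmetric]) auto
  qed
  have no: "False" if "X = {x, y}" "card Y = 2" "b \<in> Y" "A \<noteq> Y" "B \<noteq> Y" "X \<inter> Y \<noteq> {}" for X Y
    using pair[OF that(2,3)] that x y by auto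
  have "b \<in> C" using third[of C] third[of D] no[of C D] assms by metis
  moreover have "b \<in> D" using third[of C] third[of D] no[of D C] assms by (metis inf_commute)
  ultimately show ?thesis using b by blast
qed

section \<open>The automorphism group of the Clebsch cubic\<close>

context clebsch
begin

text \<open>For a permutation \<open>p\<close> of the indices this is the linear map that carries
  each \<open>r i\<close> to \<open>r (p i)\<close>.\<close>

definition M :: "(nat \<Rightarrow> nat) \<Rightarrow> 'k^4^4" where
  "M p = (\<chi> a b. \<Sum>i\<in>I. \<zeta>^(wt b * i) * r (p i) $ a)"

lemma M_apply: "M p *v v = (\<Sum>i\<in>I. ell i v *s r (p i))"
proof (subst vec_eq_iff, intro allI)
  fix a
  have "(M p *v v) $ a = (\<Sum>b\<in>UNIV. \<Sum>i\<in>I. \<zeta>^(wt b * i) * v $ b * r (p i) $ a)"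
    unfolding matrix_vector_mult_def M_def by (simp add: sum_distrib_right sum_distrib_left ac_simps)
  also have "\<dots> = (\<Sum>i\<in>I. \<Sum>b\<in>UNIV. \<zeta>^(wt b * i) * v $ b * r (p i) $ a)"
    by (rule sum.swap)
  also have "\<dots> = (\<Sum>i\<in>I. ell i v *s r (p i)) $ a"
    unfolding sum_component vector_smult_component ell_def sum_distrib_right ..
  finally show "(M p *v v) $ a = (\<Sum>i\<in>I. ell i v *s r (p i)) $ a" .
qed

text \<open>The contributions of the means 1/5 cancel because the coordinates sum to zero.\<close>

lemma ell_M:
  assumes p: "p permutes I" and j: "j \<in> I"
  shows "ell (p j) (M p *v v) = ell j v"
proof -
  have "ell (p j) (M p *v v) = (\<Sum>i\<in>I. (if i = j then ell i v else 0) - ell i v / 5)"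
    unfolding M_apply ell_sum ell_scale
  proof (intro sum.cong refl)
    fix i assume i: "i \<in> I"
    have "p i \<in> I" "p j \<in> I" "p i = p j \<longleftrightarrow> i = j"
      using p i j by (auto simp: permutes_in_image inj_eq[OF permutes_inj[OF p]] simp del: atLeastAtMost_iff)
    then show "ell i v * ell (p j) (r (p i)) = (if i = j then ell i v else 0) - ell i v / 5"
      by (simp add: ell_r right_diff_distrib)
  qed
  also have "\<dots> = ell j v"
    using j unfolding sum_subtractf sum_divide_distrib[symmetric] sum_ell by simp
  finally show ?thesis .
qed

lemma permuted_ell_inject:
  assumes p: "p permutes I" and h: "\<And>i. i \<in> I \<Longrightarrow> ell (p i) u = ell (p i) v"
  shows "u = v"
proof (rule ell_inject)
  fix i assume "i \<in> I"
  then obtain j where "j \<in> I" "i = p j"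
    using permutes_image[OF p] by blast
  then show "ell i u = ell i v" using h by simp
qed

lemma M_compose:
  assumes p: "p permutes I" and q: "q permutes I"
  shows "M (p \<circ> q) = M p ** M q"
proof (rule matrix_eq[THEN iffD2], intro allI)
  fix v
  have pq: "(p \<circ> q) permutes I" by (rule permutes_compose[OF q p])
  show "M (p \<circ> q) *v v = M p ** M q *v v"
  proof (rule permuted_ell_inject[OF pq])
    fix i assume i: "i \<in> I"
    then have "q i \<in> I" using q by (metis permutes_in_image)
    then show "ell ((p \<circ> q) i) (M (p \<circ> q) *v v) = ell ((p \<circ> q) i) (M p ** M q *v v)"
      using ell_M[OF pq i] ell_M[OF p] ell_M[OF q i]
      by (simp add: matrix_vector_mul_assoc[symmetric])
  qed
qed

lemma M_id: "M id = mat 1"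
proof (rule matrix_eq[THEN iffD2], intro allI)
  fix v
  have "M id *v v = v" unfolding M_apply id_apply by (rule reconstruct[symmetric])
  then show "M id *v v = mat 1 *v v" by simp
qed

lemma invertible_M:
  assumes p: "p permutes I"
  shows "invertible (M p)"
  unfolding invertible_right_inverse
proof
  show "M p ** M (inv' p) = mat 1"
    using M_compose[OF p permutes_inv[OF p]] by (simp add: permutes_inv_o[OF p] M_id)
qed

text \<open>The matrix only reorders the summands of the sum of five cubes.\<close>

lemma eval4_M:
  assumes p: "p permutes I"
  shows "eval4 cubic_S' (M p *v v) = eval4 cubic_S' v"
proof -
  have "\<tau> (M p *v v) (M p *v v) (M p *v v) = (\<Sum>i\<in>I. ell (p i) (M p *v v) * ell (p i) (M p *v v) * ell (p i) (M p *v v))"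
    unfolding \<tau>_def by (subst sum.permute[OF p]) (simp add: o_def)
  also have "\<dots> = \<tau> v v v"
    unfolding \<tau>_def by (intro sum.cong refl) (simp only: ell_M[OF p])
  finally show ?thesis by (simp add: \<tau>_diag)
qed

lemma M_proportional_imp_eq:
  assumes p: "p permutes I" and q: "q permutes I" and h: "M p = mat c ** M q"
  shows "p = q"
proof -
  have e: "ell j (M p *v v) = c * ell j (M q *v v)" for j v
    by (simp add: h matrix_vector_mul_assoc[symmetric] mat_mult_vector ell_scale)
  have bij: "\<exists>i\<in>I. s i = j" if "s permutes I" "j \<in> I" for s j
    using permutes_image[OF that(1)] that(2) by (metis imageE)
  show ?thesis
  proof (rule ccontr)
    assume "p \<noteq> q"
    then obtain a where a: "p a \<noteq> q a" by blast
    then have aI: "a \<in> I" using p q by (metis permutes_not_in)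
    define j where "j = p a"
    have jI: "j \<in> I" using aI p by (metis j_def permutes_in_image)
    obtain b where b: "b \<in> I" "q b = j" using bij[OF q jI] by blast
    have ab: "a \<noteq> b" using a b by (auto simp: j_def)
    have eq: "ell a v = c * ell b v" for v
      using e[of j v] ell_M[OF p aI, of v] ell_M[OF q b(1), of v] by (simp add: j_def b(2))
    have "\<exists>k\<in>I. k \<noteq> a \<and> k \<noteq> b"
    proof (rule ccontr)
      assume "\<not> (\<exists>k\<in>I. k \<noteq> a \<and> k \<noteq> b)"
      then have "I \<subseteq> {a, b}" by blast
      then have "card I \<le> card {a, b}" by (intro card_mono) auto
      also have "\<dots> \<le> 2" by (simp add: card_insert_if)
      finally show False by simp
    qed
    then obtain k where k: "k \<in> I" "k \<noteq> a" "k \<noteq> b" by blast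
    \<comment> \<open>The forms \<open>ell a\<close> and \<open>ell b\<close> both take the value
      -1/5 at \<open>r k\<close>, which forces the factor 1; but \<open>dd a k\<close> gives 1 and 0
      and separates them.\<close>
    have "c = 1" using eq[of "r k"] k aI b(1) by (simp add: ell_r)
    then show False using eq[of "dd a k"] ab k aI b(1) by (simp add: ell_dd)
  qed
qed

text \<open>Rank at most 2 of the polar quadric of \<open>u\<close>, expressed as corank at least 2.\<close>

definition degenerate :: "'k^4 \<Rightarrow> bool" where
  "degenerate u \<longleftrightarrow> (\<exists>v w. (\<forall>a b. a *s v + b *s w = 0 \<longrightarrow> a = 0 \<and> b = 0)
     \<and> (\<forall>x. \<tau> u v x = 0) \<and> (\<forall>x. \<tau> u w x = 0))"

text \<open>Only the coordinates \<open>i\<close> and \<open>j\<close> of \<open>dd i j\<close> can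
  be nonzero, so vectors supported on three other indices lie in the kernel; those with coordinate
  sum zero include the independent \<open>dd a b\<close> and \<open>dd a c\<close>.\<close>

lemma degenerate_dd:
  assumes "i \<in> I" "j \<in> I"
  shows "degenerate (dd i j)"
proof -
  have "card {i, j} \<le> 2" by (simp add: card_insert_if)
  moreover have "card (I - {i, j}) = 5 - card {i, j}"
    using assms by (subst card_Diff_subset) auto
  ultimately have "3 \<le> card (I - {i, j})" by simp
  then obtain S where S: "S \<subseteq> I - {i, j}" "card S = 3"
    by (meson obtain_subset_with_card_n)
  then obtain a b c where abc: "S = {a, b, c}" "a \<noteq> b" "a \<noteq> c" "b \<noteq> c"
    by (auto simp: card_3_iff)
  then have I: "a \<in> I" "b \<in> I" "c \<in> I" and ne: "a \<noteq> i" "a \<noteq> j" "b \<noteq> i" "b \<noteq> j" "c \<noteq> i" "c \<noteq> j"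
    using S by auto
  have ker: "\<forall>x. \<tau> (dd i j) (dd a k) x = 0" if k: "k \<in> I" "k \<noteq> i" "k \<noteq> j" for k
  proof -
    have "\<forall>m\<in>I. ell m (dd i j) * ell m (dd a k) = 0"
      using k I ne assms by (simp add: ell_dd del: atLeastAtMost_iff)
    then show ?thesis by (metis \<tau>_kernel)
  qed
  have "x = 0 \<and> y = 0" if h: "x *s dd a b + y *s dd a c = 0" for x y
  proof -
    have "ell m (x *s dd a b + y *s dd a c) = 0" for m by (simp add: h)
    from this[of b] this[of c] show ?thesis
      using I abc by (simp add: ell_add ell_scale ell_dd del: atLeastAtMost_iff)
  qed
  then show ?thesis
    unfolding degenerate_def using ker[OF I(2)] ker[OF I(3)] ne by blast
qed

lemma degenerate_imp_dd:
  assumes deg: "degenerate u" and u: "u \<noteq> 0"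
  obtains i j c where "i \<in> I" "j \<in> I" "i \<noteq> j" "c \<noteq> 0" "u = c *s dd i j"
proof -
  obtain v w where ind: "\<And>a b. a *s v + b *s w = 0 \<Longrightarrow> a = 0 \<and> b = 0"
    and v: "\<forall>x. \<tau> u v x = 0" and w: "\<forall>x. \<tau> u w x = 0"
    using deg by (auto simp: degenerate_def)
  txt \<open>If \<open>\<kappa> \<noteq> 0\<close> or \<open>\<mu> \<noteq> 0\<close>, all coordinates of \<open>u\<close> are nonzero, and \<open>v\<close> and \<open>w\<close> are both
    proportional to the vector of their inverses.\<close>
  define \<kappa> \<mu> where "\<kappa> = ell 1 u * ell 1 v" and "\<mu> = ell 1 u * ell 1 w"
  have "1 \<in> I" by simp
  then have \<kappa>: "ell i u * ell i v = \<kappa>" and \<mu>: "ell i u * ell i w = \<mu>" if "i \<in> I" for i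
    using v w that unfolding \<tau>_kernel \<kappa>_def \<mu>_def by blast+
  have "\<kappa> = 0 \<and> \<mu> = 0"
  proof (rule ccontr)
    assume "\<not> (\<kappa> = 0 \<and> \<mu> = 0)"
    then have nz: "ell i u \<noteq> 0" if "i \<in> I" for i
      using \<kappa>[OF that] \<mu>[OF that] by auto
    have "\<mu> *s v + (- \<kappa>) *s w = 0"
    proof (rule ell_inject)
      fix i assume i: "i \<in> I"
      have "ell i u * (\<mu> * ell i v - \<kappa> * ell i w) = \<mu> * (ell i u * ell i v) - \<kappa> * (ell i u * ell i w)"
        by (simp add: algebra_simps)
      also have "\<dots> = 0" by (simp add: \<kappa>[OF i] \<mu>[OF i])
      finally show "ell i (\<mu> *s v + (- \<kappa>) *s w) = ell i 0"
        using nz[OF i] by (simp add: ell_diff ell_scale)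
    qed
    from ind[OF this] \<open>\<not> (\<kappa> = 0 \<and> \<mu> = 0)\<close> show False by simp
  qed
  then have v0: "ell i v = 0" and w0: "ell i w = 0" if "i \<in> I" "ell i u \<noteq> 0" for i
    using \<kappa>[OF that(1)] \<mu>[OF that(1)] that(2) by auto
  \<comment> \<open>Both kernel vectors vanish on the support \<open>Z\<close> of \<open>u\<close>.
    Three indices in \<open>Z\<close> would leave them two coordinates with sum zero, hence a line,
    against independence. Since the coordinates of \<open>u\<close> sum to zero, \<open>Z\<close>
    cannot be a single index either.\<close>
  define Z where "Z = {i \<in> I. ell i u \<noteq> 0}"
  have fin: "finite Z" and ZI: "Z \<subseteq> I" by (auto simp: Z_def)
  have sumZ: "(\<Sum>i\<in>Z. ell i u) = 0"
    unfolding sum_ell[of u, symmetric] by (rule sum.mono_neutral_left) (auto simp: Z_def)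
  have "card Z < 3"
  proof (rule ccontr)
    assume "\<not> card Z < 3"
    then obtain S where S: "S \<subseteq> Z" "card S = 3"
      by (meson not_less obtain_subset_with_card_n)
    have "card (I - S) = 2"
      using S ZI by (subst card_Diff_subset) (auto intro: finite_subset[OF _ fin])
    then obtain a b where ab: "I - S = {a, b}" "a \<noteq> b" by (auto simp: card_2_iff)
    have vanish: "ell i x = 0" if "i \<in> S" "x \<in> {v, w}" for i x
      using that S v0[of i] w0[of i] by (auto simp: Z_def)
    have two: "ell a x + ell b x = 0" if "x \<in> {v, w}" for x
    proof -
      have "(\<Sum>i\<in>{a, b}. ell i x) = (\<Sum>i\<in>I. ell i x)"
        unfolding ab(1)[symmetric] by (rule sum.mono_neutral_left) (use vanish that in auto)
      then show ?thesis using ab(2) by (simp only: sum_ell) simp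
    qed
    have bv: "ell b v = - ell a v" and bw: "ell b w = - ell a w"
      using two[of v] two[of w] by (simp_all add: eq_neg_iff_add_eq_0 add.commute)
    have zero: "x = 0" if ax: "ell a x = 0" and bx: "ell b x = 0" and Sx: "\<And>i. i \<in> S \<Longrightarrow> ell i x = 0" for x
    proof (rule ell_inject)
      fix i assume "i \<in> I"
      then have "i \<in> S \<or> i = a \<or> i = b" using ab(1) by blast
      then show "ell i x = ell i 0" using Sx ax bx by auto
    qed
    have "ell a w *s v + (- ell a v) *s w = 0"
    proof (rule zero)
      show "ell a (ell a w *s v + (- ell a v) *s w) = 0" "ell b (ell a w *s v + (- ell a v) *s w) = 0"
        unfolding ell_add ell_scale bv bw by simp_all
      show "ell i (ell a w *s v + (- ell a v) *s w) = 0" if "i \<in> S" for i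
        unfolding ell_add ell_scale using vanish[OF that] by simp
    qed
    then have "ell a w = 0" using ind by blast
    then have "w = 0" by (intro zero) (simp_all add: bw vanish)
    then have "0 *s v + 1 *s w = 0" by simp
    then show False using ind[of 0 1] by simp
  qed
  moreover have "card Z \<noteq> 0"
  proof
    assume "card Z = 0"
    then have "u = 0" using fin by (intro ell_inject) (auto simp: Z_def)
    then show False using u by simp
  qed
  moreover have "card Z \<noteq> 1"
  proof
    assume "card Z = 1"
    then obtain i where "Z = {i}" by (auto simp: card_1_singleton_iff)
    then show False using sumZ by (auto simp: Z_def)
  qed
  ultimately have "card Z = 2" by simp
  then obtain i j where ij: "Z = {i, j}" "i \<noteq> j" by (auto simp: card_2_iff)
  then have ji: "ell j u = - ell i u" using sumZ by (simp add: add_eq_0_iff)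
  have I: "i \<in> I" "j \<in> I" and nz: "ell i u \<noteq> 0" using ij by (auto simp: Z_def)
  have "u = ell i u *s dd i j"
  proof (rule ell_inject)
    fix k assume k: "k \<in> I"
    then have "k \<noteq> i \<Longrightarrow> k \<noteq> j \<Longrightarrow> ell k u = 0" using ij by (auto simp: Z_def)
    then show "ell k u = ell k (ell i u *s dd i j)"
      unfolding ell_scale ell_dd[OF I k] using ij(2) ji by (cases "k = i"; cases "k = j") auto
  qed
  then show ?thesis using that[OF I ij(2) nz] by blast
qed

text \<open>
  The images of the four vectors \<open>dd i 5\<close> are, up to scalars, again such differences; regarded as edges of
  the complete graph on \<open>{1..5}\<close> they meet pairwise, hence form a star, whose centre is the image of 5.
\<close>

lemma automorphism_is_M:
  assumes B: "invertible B" and c: "c \<noteq> 0" "\<And>v. eval4 cubic_S' v = c * eval4 cubic_S' (B *v v)"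
  obtains p d where "p permutes I" "d \<noteq> 0" "B = mat d ** M p"
proof -
  have Binj: "u = 0" if "B *v u = 0" for u
    using matrix_inv_cancel(2)[OF B, of u] that by simp
  have B_add: "B *v (u + v) = B *v u + B *v v" for u v by (rule matrix_vector_right_distrib)
  have B_diff: "B *v (u - v) = B *v u - B *v v" for u v by (rule matrix_vector_mult_diff_distrib)
  have B_scale: "B *v (x *s u) = x *s (B *v u)" for x u by (rule vector_scalar_commute)
  have "\<tau> (B *v v) (B *v v) (B *v v) = 1 / c * \<tau> v v v" for v
    using c(1) by (simp add: \<tau>_diag c(2)[of v])
  then have \<tau>B: "\<tau> (B *v u) (B *v v) (B *v w) = 1 / c * \<tau> u v w" for u v w
    by (rule \<tau>.semi_invariant[where B = "\<lambda>v. B *v v", OF B_add])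
  have degB: "degenerate (B *v u)" if deg: "degenerate u" for u
  proof -
    obtain v w where ind: "\<And>x y. x *s v + y *s w = 0 \<Longrightarrow> x = 0 \<and> y = 0"
      and v: "\<And>x. \<tau> u v x = 0" and w: "\<And>x. \<tau> u w x = 0"
      using deg by (auto simp: degenerate_def)
    have "\<tau> (B *v u) (B *v v) x = 0" "\<tau> (B *v u) (B *v w) x = 0" for x
      using \<tau>B[of u v "matrix_inv B *v x"] \<tau>B[of u w "matrix_inv B *v x"]
      by (simp_all add: matrix_inv_cancel[OF B] v w)
    moreover have "x = 0 \<and> y = 0" if "x *s (B *v v) + y *s (B *v w) = 0" for x y
      by (rule ind[OF Binj]) (use that in \<open>simp add: B_add B_scale\<close>)
    ultimately show ?thesis unfolding degenerate_def by blast
  qed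
  have edge: "\<exists>k l e. k \<in> I \<and> l \<in> I \<and> k \<noteq> l \<and> e \<noteq> 0 \<and> B *v dd i j = e *s dd k l"
    if "i \<in> I" "j \<in> I" "i \<noteq> j" for i j
  proof -
    have "ell i (dd i j) = 1" using that by (simp add: ell_dd del: atLeastAtMost_iff)
    then have "dd i j \<noteq> 0" by (metis ell_zero zero_neq_one)
    then have "B *v dd i j \<noteq> 0" using Binj by blast
    from degenerate_imp_dd[OF degB[OF degenerate_dd] this] that show ?thesis by metis
  qed
  \<comment> \<open>The image of a difference has at most two nonzero coordinates; this excludes
    disjoint edges and later forces the scalars to agree.\<close>
  have three: "ell x (B *v dd i j) = 0 \<or> ell y (B *v dd i j) = 0 \<or> ell z (B *v dd i j) = 0"
    if ij: "i \<in> I" "j \<in> I" "i \<noteq> j" and xyz: "x \<in> I" "y \<in> I" "z \<in> I" "x \<noteq> y" "x \<noteq> z" "y \<noteq> z" for i j x y z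
  proof -
    obtain k l e where k: "k \<in> I" "l \<in> I" "B *v dd i j = e *s dd k l"
      using edge[OF ij] by blast
    show ?thesis unfolding k(3) ell_scale ell_dd[OF k(1,2) xyz(1)] ell_dd[OF k(1,2) xyz(2)] ell_dd[OF k(1,2) xyz(3)]
      using xyz(4-6) by auto
  qed
  define J :: "nat set" where "J = {1, 2, 3, 4}"
  have J: "i \<in> I" "i \<noteq> 5" if "i \<in> J" for i using that by (auto simp: J_def)
  have I5: "5 \<in> I" by simp
  have dd5: "B *v dd i j = B *v dd i 5 - B *v dd j 5" for i j
    unfolding B_diff[symmetric] by (simp add: dd_def)
  \<comment> \<open>Images of different \<open>dd i 5\<close> and \<open>dd j 5\<close> cannot be
    proportional, since \<open>B\<close> is injective.\<close>
  have indep: "y = 0" if "i \<in> J" "j \<in> J" "i \<noteq> j" "B *v dd i 5 = x *s D" "B *v dd j 5 = y *s D" for i j x y D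
  proof -
    have "B *v (y *s dd i 5 - x *s dd j 5) = 0"
      by (simp add: B_diff B_scale that(4,5) mult.commute)
    then have "y *s dd i 5 - x *s dd j 5 = 0" by (rule Binj)
    then have "ell i (y *s dd i 5 - x *s dd j 5) = 0" by (simp only: ell_zero)
    then show ?thesis
      using that(3) J(2)[OF that(1)]
      by (simp add: ell_diff ell_scale ell_dd[OF J(1)[OF that(1)] I5 J(1)[OF that(1)]] ell_dd[OF J(1)[OF that(2)] I5 J(1)[OF that(1)]])
  qed
  have "\<forall>i\<in>J. \<exists>k l e. k \<in> I \<and> l \<in> I \<and> k \<noteq> l \<and> e \<noteq> 0 \<and> B *v dd i 5 = e *s dd k l"
    using edge J I5 by blast
  then obtain a b e where abe: "\<And>i. i \<in> J \<Longrightarrow> a i \<in> I \<and> b i \<in> I \<and> a i \<noteq> b i \<and> e i \<noteq> 0 \<and> B *v dd i 5 = e i *s dd (a i) (b i)"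
    by metis
  have dd_swap: "e *s dd l k = (- e) *s dd k l" for e k l
    by (simp add: dd_def vec_eq_iff algebra_simps)
  have inter: "{a i, b i} \<inter> {a j, b j} \<noteq> {}" if ij: "i \<in> J" "j \<in> J" "i \<noteq> j" for i j
  proof
    assume disj: "{a i, b i} \<inter> {a j, b j} = {}"
    have I: "a i \<in> I" "b i \<in> I" "a j \<in> I" "b j \<in> I" and ne: "a i \<noteq> b i" "a j \<noteq> b j" and nz: "e i \<noteq> 0" "e j \<noteq> 0"
      using abe ij by blast+
    have ne': "a i \<noteq> a j" "a i \<noteq> b j" "b i \<noteq> a j" "b i \<noteq> b j" using disj by auto
    have "B *v dd i j = e i *s dd (a i) (b i) - e j *s dd (a j) (b j)"
      using abe ij by (simp add: dd5[of i j])
    then have l: "ell k (B *v dd i j) = e i * ell k (dd (a i) (b i)) - e j * ell k (dd (a j) (b j))" for k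
      by (simp add: ell_diff ell_scale)
    have "ell (a i) (B *v dd i j) \<noteq> 0" "ell (b i) (B *v dd i j) \<noteq> 0" "ell (a j) (B *v dd i j) \<noteq> 0"
      using I ne ne' nz by (simp_all add: l ell_dd del: atLeastAtMost_iff)
    then show False
      using three[OF J(1)[OF ij(1)] J(1)[OF ij(2)] ij(3) I(1,2,3) ne(1) ne'(1,3)] by blast
  qed
  have neq: "{a i, b i} \<noteq> {a j, b j}" if ij: "i \<in> J" "j \<in> J" "i \<noteq> j" for i j
  proof
    assume "{a i, b i} = {a j, b j}"
    then have "a i = a j \<and> b i = b j \<or> a i = b j \<and> b i = a j" by (auto simp: doubleton_eq_iff)
    then have "B *v dd j 5 = e j *s dd (a i) (b i) \<or> B *v dd j 5 = (- e j) *s dd (a i) (b i)"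
      using abe[OF ij(2)] dd_swap[of "e j" "b i" "a i"] by metis
    then have "e j = 0 \<or> - e j = 0" using indep[OF ij] abe[OF ij(1)] by metis
    then show False using abe[OF ij(2)] by simp
  qed
  have mem: "1 \<in> J" "2 \<in> J" "3 \<in> J" "4 \<in> J" by (simp_all add: J_def)
  have card: "card {a i, b i} = 2" if "i \<in> J" for i using abe[OF that] by simp
  have ne: "(1::nat) \<noteq> 2" "(1::nat) \<noteq> 3" "(1::nat) \<noteq> 4" "(2::nat) \<noteq> 3" "(2::nat) \<noteq> 4" "(3::nat) \<noteq> 4"
    by simp_all
  obtain q where "q \<in> {a 1, b 1} \<and> q \<in> {a 2, b 2} \<and> q \<in> {a 3, b 3} \<and> q \<in> {a 4, b 4}"
    using four_pairwise_intersecting_pairs[OF card[OF mem(1)] card[OF mem(2)] card[OF mem(3)] card[OF mem(4)]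
      neq[OF mem(1,2) ne(1)] neq[OF mem(1,3) ne(2)] neq[OF mem(1,4) ne(3)] neq[OF mem(2,3) ne(4)]
      neq[OF mem(2,4) ne(5)] neq[OF mem(3,4) ne(6)]
      inter[OF mem(1,2) ne(1)] inter[OF mem(1,3) ne(2)] inter[OF mem(1,4) ne(3)] inter[OF mem(2,3) ne(4)]
      inter[OF mem(2,4) ne(5)] inter[OF mem(3,4) ne(6)]] by blast
  then have q: "q \<in> {a i, b i}" if "i \<in> J" for i
    using that by (auto simp: J_def)
  have qI: "q \<in> I" using q[OF mem(1)] abe[OF mem(1)] by auto
  \<comment> \<open>Each edge is oriented towards the centre \<open>q\<close>; a reversal is
    absorbed into the sign of the scalar.\<close>
  have "\<forall>i\<in>J. \<exists>k e. k \<in> I \<and> k \<noteq> q \<and> e \<noteq> 0 \<and> B *v dd i 5 = e *s dd k q"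
  proof
    fix i assume i: "i \<in> J"
    note ab = abe[OF i]
    show "\<exists>k e. k \<in> I \<and> k \<noteq> q \<and> e \<noteq> 0 \<and> B *v dd i 5 = e *s dd k q"
    proof (cases "q = b i")
      case True
      then show ?thesis using ab by blast
    next
      case False
      then have "q = a i" using q[OF i] by simp
      moreover have "- e i \<noteq> 0" using ab by simp
      moreover have "B *v dd i 5 = (- e i) *s dd (b i) (a i)"
        using ab dd_swap[of "e i" "a i" "b i"] by metis
      ultimately show ?thesis using ab by metis
    qed
  qed
  then obtain k g where kg: "\<And>i. i \<in> J \<Longrightarrow> k i \<in> I \<and> k i \<noteq> q \<and> g i \<noteq> 0 \<and> B *v dd i 5 = g i *s dd (k i) q"
    by metis
  have k_inj: "k i \<noteq> k j" if ij: "i \<in> J" "j \<in> J" "i \<noteq> j" for i j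
    using indep[OF ij, of "g i" "dd (k i) q" "g j"] kg[OF ij(1)] kg[OF ij(2)] by metis
  \<comment> \<open>The image of \<open>dd i j\<close> is nonzero at \<open>k i\<close> and
    \<open>k j\<close>, so its coordinate \<open>g j - g i\<close> at \<open>q\<close> must
    vanish.\<close>
  have g_const: "g i = g j" if ij: "i \<in> J" "j \<in> J" "i \<noteq> j" for i j
  proof -
    have I: "k i \<in> I" "k j \<in> I" and ne: "k i \<noteq> q" "k j \<noteq> q" and nz: "g i \<noteq> 0" "g j \<noteq> 0"
      using kg ij by blast+
    have "B *v dd i j = g i *s dd (k i) q - g j *s dd (k j) q"
      using kg ij by (simp add: dd5[of i j])
    then have l: "ell m (B *v dd i j) = g i * ell m (dd (k i) q) - g j * ell m (dd (k j) q)" for m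
      by (simp add: ell_diff ell_scale)
    have "ell (k i) (B *v dd i j) \<noteq> 0" "ell (k j) (B *v dd i j) \<noteq> 0" "ell q (B *v dd i j) = g j - g i"
      using I qI ne nz k_inj[OF ij] by (simp_all add: l ell_dd del: atLeastAtMost_iff)
    then show ?thesis
      using three[OF J(1)[OF ij(1)] J(1)[OF ij(2)] ij(3) I qI k_inj[OF ij] ne] by simp
  qed
  define d where "d = g 1"
  have d: "d \<noteq> 0" using kg[OF mem(1)] by (simp add: d_def)
  have gd: "g i = d" if "i \<in> J" for i
    using g_const[OF that mem(1)] by (auto simp: d_def)
  define p where "p i = (if i \<in> J then k i else if i = 5 then q else i)" for i
  have IJ: "I = insert 5 J" by (auto simp: J_def)
  have pJ: "p i = k i" if "i \<in> J" for i using that by (simp add: p_def)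
  have p5: "p 5 = q" by (simp add: p_def J_def)
  have p_inj: "inj_on p I"
    unfolding IJ inj_on_def using k_inj kg pJ p5 by (metis insert_iff)
  have p_I: "p ` I \<subseteq> I"
  proof
    fix y assume "y \<in> p ` I"
    then obtain x where x: "x \<in> insert 5 J" "y = p x" unfolding IJ by blast
    then show "y \<in> I" using kg[of x] pJ[of x] p5 qI by (cases "x = 5") auto
  qed
  have p: "p permutes I"
  proof (rule bij_imp_permutes)
    show "bij_betw p I I" using p_inj endo_inj_surj[OF _ p_I p_inj] by (simp add: bij_betw_def)
    show "p x = x" if "x \<notin> I" for x using that unfolding IJ p_def by auto
  qed
  have Mdd: "M p *v dd i 5 = dd (p i) (p 5)" if i: "i \<in> J" for i
  proof (rule permuted_ell_inject[OF p])
    fix m assume m: "m \<in> I"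
    have inI: "p m \<in> I" "p i \<in> I" "p 5 \<in> I" using p_I m J(1)[OF i] I5 by blast+
    have eq: "p m = p x \<longleftrightarrow> m = x" for x using permutes_inj[OF p] by (auto dest: injD)
    show "ell (p m) (M p *v dd i 5) = ell (p m) (dd (p i) (p 5))"
      unfolding ell_M[OF p m] ell_dd[OF J(1)[OF i] I5 m] ell_dd[OF inI(2,3,1)] eq ..
  qed
  have Bdd: "B *v dd i 5 = d *s (M p *v dd i 5)" if "i \<in> J" for i
    using kg[OF that] by (simp add: Mdd[OF that] pJ[OF that] p5 gd[OF that])
  \<comment> \<open>The four vectors \<open>dd i 5\<close> form a basis with coordinate functions
    \<open>ell i\<close>; the fifth coordinate is determined by the zero sum.\<close>
  have expand: "v = ell 1 v *s dd 1 5 + (ell 2 v *s dd 2 5 + (ell 3 v *s dd 3 5 + ell 4 v *s dd 4 5))" for v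
  proof (rule ell_inject)
    fix m assume m: "m \<in> I"
    have II: "I = {1,2,3,4,5}" by auto
    have "ell 5 v = - (ell 1 v + ell 2 v + ell 3 v + ell 4 v)"
      using sum_ell[of v] unfolding II by (subst eq_neg_iff_add_eq_0) (simp add: add_ac)
    moreover have "m = 1 \<or> m = 2 \<or> m = 3 \<or> m = 4 \<or> m = 5" using m II by blast
    ultimately show "ell m v = ell m (ell 1 v *s dd 1 5 + (ell 2 v *s dd 2 5 + (ell 3 v *s dd 3 5 + ell 4 v *s dd 4 5)))"
      unfolding ell_add ell_scale ell_dd[OF J(1)[OF mem(1)] I5 m] ell_dd[OF J(1)[OF mem(2)] I5 m]
        ell_dd[OF J(1)[OF mem(3)] I5 m] ell_dd[OF J(1)[OF mem(4)] I5 m]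
      by (elim disjE) simp_all
  qed
  have "B = mat d ** M p"
  proof (rule matrix_eq[THEN iffD2], intro allI)
    fix v
    have "B *v v = d *s (M p *v v)"
      by (subst (1 2) expand)
        (simp only: B_add B_scale Bdd[OF mem(1)] Bdd[OF mem(2)] Bdd[OF mem(3)] Bdd[OF mem(4)]
          matrix_vector_right_distrib vector_scalar_commute vector_add_ldistrib vector_smult_assoc mult.commute[of d])
    then show "B *v v = (mat d ** M p) *v v"
      by (simp add: matrix_vector_mul_assoc[symmetric] mat_mult_vector)
  qed
  with p d show ?thesis by (rule that)
qed

section \<open>The isomorphism with the symmetric group\<close>

lemma Aut_cubic_S'_iso: "Aut (cubic_S' :: 'k poly4) \<cong> sym_group 5"
proof -
  let ?A = "Aut (cubic_S' :: 'k poly4)"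
  have "(\<lambda>p. PGL_class (M p)) \<in> iso (sym_group 5) ?A"
  proof (rule isoI)
    show "(\<lambda>p. PGL_class (M p)) \<in> hom (sym_group 5) ?A"
    proof (rule homI)
      fix p assume "p \<in> carrier (sym_group 5)"
      then have p: "p permutes I" by (simp add: sym_group_carrier)
      have "(1::'k) \<noteq> 0 \<and> (\<forall>v. eval4 cubic_S' v = 1 * eval4 cubic_S' (M p *v v))"
        by (simp add: eval4_M[OF p])
      then show "PGL_class (M p) \<in> carrier ?A"
        unfolding carrier_Aut using invertible_M[OF p] by blast
    next
      fix p q assume "p \<in> carrier (sym_group 5)" "q \<in> carrier (sym_group 5)"
      then have pq: "p permutes I" "q permutes I" by (simp_all add: sym_group_carrier)
      show "PGL_class (M (p \<otimes>\<^bsub>sym_group 5\<^esub> q)) = PGL_class (M p) \<otimes>\<^bsub>?A\<^esub> PGL_class (M q)"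
        by (simp add: sym_group_mult mult_Aut PGL_class_mult M_compose[OF pq] invertible_M[OF pq(1)] invertible_M[OF pq(2)])
    qed
    show "bij_betw (\<lambda>p. PGL_class (M p)) (carrier (sym_group 5)) (carrier ?A)"
      unfolding bij_betw_def
    proof
      show "inj_on (\<lambda>p. PGL_class (M p)) (carrier (sym_group 5))"
        by (rule inj_onI) (auto simp: sym_group_carrier PGL_class_eq_iff intro: M_proportional_imp_eq)
      show "(\<lambda>p. PGL_class (M p)) ` carrier (sym_group 5) = carrier ?A"
      proof
        show "(\<lambda>p. PGL_class (M p)) ` carrier (sym_group 5) \<subseteq> carrier ?A"
          using \<open>(\<lambda>p. PGL_class (M p)) \<in> hom (sym_group 5) ?A\<close> by (auto simp: hom_def)
        show "carrier ?A \<subseteq> (\<lambda>p. PGL_class (M p)) ` carrier (sym_group 5)"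
        proof
          fix X assume "X \<in> carrier ?A"
          then obtain B c where X: "X = PGL_class B" "invertible B" "c \<noteq> 0"
            "\<And>v. eval4 cubic_S' v = c * eval4 cubic_S' (B *v v)"
            unfolding carrier_Aut by blast
          obtain p d where "p permutes I" "d \<noteq> 0" "B = mat d ** M p"
            using automorphism_is_M[OF X(2-4)] by blast
          then have "X = PGL_class (M p)" "p \<in> carrier (sym_group 5)"
            using X(1) by (auto simp: sym_group_carrier PGL_class_eq_iff)
          then show "X \<in> (\<lambda>p. PGL_class (M p)) ` carrier (sym_group 5)" by blast
        qed
      qed
    qed
  qed
  then have "sym_group 5 \<cong> ?A" by (rule is_isoI)
  then show ?thesis by (rule group.iso_sym[OF sym_group_is_group])
qed

end

section \<open>Cubics with an automorphism of order five\<close>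

lemma clebsch_root_exists: "\<exists>\<zeta> :: 'k::{alg_closed_field, field_char_0}. clebsch \<zeta>"
proof -
  have "degree [:1, 1, 1, 1, 1 :: 'k:] > 0" by simp
  from alg_closed_imp_poly_has_root[OF this] obtain z :: 'k where "poly [:1, 1, 1, 1, 1:] z = 0" by blast
  then have "1 + z + z^2 + z^3 + z^4 = 0"
    by (simp add: algebra_simps power_numeral_reduce)
  then show ?thesis by (auto simp: clebsch_def)
qed

lemma clebsch_of_fifth_root:
  fixes \<eta> :: "'k::field_char_0"
  assumes "\<eta>^5 = 1" "\<eta> \<noteq> 1"
  shows "clebsch \<eta>"
proof
  have "(\<eta> - 1) * (1 + \<eta> + \<eta>^2 + \<eta>^3 + \<eta>^4) = \<eta>^5 - 1"
    by (simp add: algebra_simps power_numeral_reduce)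
  then show "1 + \<eta> + \<eta>^2 + \<eta>^3 + \<eta>^4 = 0" using assms by simp
qed

section \<open>Eigenbases of matrices whose fifth power is scalar\<close>

lemma column_matrix_vector: "(\<chi> i j. b j $ i) *v x = (\<Sum>j\<in>UNIV. x $ j *s (b j :: 'k::field^4))"
proof -
  have "column j (\<chi> i j. b j $ i) = b j" for j by (simp add: column_def vec_eq_iff)
  then show ?thesis by (simp add: matrix_mult_sum)
qed

lemma invertible_column_matrix:
  fixes b :: "4 \<Rightarrow> 'k::field^4"
  assumes "vec.span (range b) = UNIV"
  shows "invertible (\<chi> i j. b j $ i)"
proof -
  have "columns (\<chi> i j. b j $ i) = range b"
    by (auto simp: columns_def column_def vec_eq_iff image_def)
  then show ?thesis
    unfolding invertible_right_inverse matrix_right_invertible_span_columns using assms by simp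
qed

lemma span_range_expand:
  fixes b :: "4 \<Rightarrow> 'k::field^4"
  assumes "vec.span (range b) = UNIV"
  obtains x where "v = (\<Sum>j\<in>UNIV. x j *s b j)"
proof -
  have "v = (\<chi> i j. b j $ i) *v (matrix_inv (\<chi> i j. b j $ i) *v v)"
    by (simp add: matrix_inv_cancel[OF invertible_column_matrix[OF assms]])
  then show ?thesis unfolding column_matrix_vector by (rule that)
qed

text \<open>The polynomial \<open>X^5 - e\<close> splits into distinct linear factors, so
  \<open>A\<close> is diagonalizable. The proof writes each vector explicitly as a combination of
  eigenvectors.\<close>

lemma (in clebsch) eigenbasis:
  assumes e: "e \<noteq> 0" "\<delta>^5 = e" and A: "\<And>v. A *v (A *v (A *v (A *v (A *v v)))) = e *s v"
  shows "\<exists>b \<nu>. vec.span (range (b :: 4 \<Rightarrow> 'k^4)) = UNIV \<and> (\<forall>i. A *v b i = \<nu> i *s b i) \<and> (\<forall>i. \<nu> i ^ 5 = e)"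
proof -
  define E where "E = {u. \<exists>\<nu>. \<nu>^5 = e \<and> A *v u = \<nu> *s u}"
  have A_add: "A *v (u + v) = A *v u + A *v v" for u v by (rule matrix_vector_right_distrib)
  have A_scale: "A *v (x *s u) = x *s (A *v u)" for x u by (rule vector_scalar_commute)
  have \<delta>: "\<delta> \<noteq> 0" using e by auto
  \<comment> \<open>These are the reciprocals of the five candidate eigenvalues.\<close>
  define \<theta> where "\<theta> j = \<zeta>^j / \<delta>" for j :: nat
  have "\<zeta> \<noteq> 0" using zeta5 by auto
  then have \<theta>0: "\<theta> j \<noteq> 0" for j using \<delta> by (simp add: \<theta>_def)
  have \<theta>5: "\<theta> j ^ 5 * e = 1" for j
  proof -
    have "(\<zeta>^j)^5 = 1" by (metis power_mult mult.commute power_one zeta5)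
    then show ?thesis using e by (simp add: \<theta>_def power_divide)
  qed
  \<comment> \<open>Applying \<open>\<theta> j\<close> times \<open>A\<close> shifts the five
    summands cyclically, so \<open>w (\<theta> j) v\<close> is zero or an eigenvector for
    \<open>1 / \<theta> j\<close>. Summing over \<open>j\<close> leaves \<open>5 *s v\<close>, as
    the power sums of the \<open>\<theta> j\<close> vanish.\<close>
  define w where "w \<theta> v = v + (\<theta> *s (A *v v) + (\<theta>^2 *s (A *v (A *v v)) + (\<theta>^3 *s (A *v (A *v (A *v v)))
     + \<theta>^4 *s (A *v (A *v (A *v (A *v v)))))))" for \<theta> v
  have wE: "w (\<theta> j) v \<in> E" for j v
  proof -
    let ?t = "\<theta> j"
    have "?t *s (A *v w ?t v) = ?t *s (A *v v) + (?t^2 *s (A *v (A *v v)) + (?t^3 *s (A *v (A *v (A *v v)))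
       + (?t^4 *s (A *v (A *v (A *v (A *v v)))) + (?t^5 * e) *s v)))"
      unfolding w_def A_add A_scale A vector_add_ldistrib vector_smult_assoc
      by (simp add: power_numeral_reduce mult.assoc)
    also have "\<dots> = w ?t v" unfolding \<theta>5 w_def by (simp add: add_ac)
    finally have "(1 / ?t) *s w ?t v = A *v w ?t v"
      using \<theta>0[of j] by (metis vector_smult_assoc vector_smult_lid nonzero_divide_eq_eq mult_1)
    moreover have "(1 / ?t)^5 = e" using \<theta>5[of j] \<theta>0[of j] by (simp add: power_divide field_simps)
    ultimately show ?thesis unfolding E_def by (metis (mono_tags, lifting) mem_Collect_eq)
  qed
  have S: "(\<Sum>j\<in>I. \<theta> j ^ k) = 0" if "\<not> 5 dvd k" for k
  proof -
    have "(\<Sum>j\<in>I. \<theta> j ^ k) = (\<Sum>j\<in>I. \<zeta>^(k*j)) / \<delta>^k"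
      unfolding sum_divide_distrib \<theta>_def by (simp add: power_divide power_mult[symmetric] mult.commute)
    then show ?thesis using that by (simp only: zeta_sum5) simp
  qed
  have S4: "(\<Sum>j\<in>I. \<theta> j) = 0" "(\<Sum>j\<in>I. \<theta> j ^ 2) = 0" "(\<Sum>j\<in>I. \<theta> j ^ 3) = 0" "(\<Sum>j\<in>I. \<theta> j ^ 4) = 0"
    using S[of 1] S[of 2] S[of 3] S[of 4] by simp_all
  have "v \<in> vec.span E" for v
  proof -
    have "(\<Sum>j\<in>I. w (\<theta> j) v) = 5 *s v"
    proof (subst vec_eq_iff, intro allI)
      fix a
      show "(\<Sum>j\<in>I. w (\<theta> j) v) $ a = (5 *s v) $ a"
        unfolding sum_component w_def vector_add_component vector_smult_component sum.distrib
          sum_distrib_right[symmetric] S4 by simp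
    qed
    then have "v = (1 / 5) *s (\<Sum>j\<in>I. w (\<theta> j) v)"
      by (simp add: vector_smult_assoc)
    moreover have "(1 / 5) *s (\<Sum>j\<in>I. w (\<theta> j) v) \<in> vec.span E"
      by (intro vec.span_scale vec.span_sum vec.span_base wE)
    ultimately show ?thesis by simp
  qed
  then have spanE: "vec.span E = UNIV" by blast
  obtain B where B: "B \<subseteq> E" "vec.independent B" "E \<subseteq> vec.span B" "card B = vec.dim E"
    by (rule vec.basis_exists)
  have spanB: "vec.span B = UNIV"
    using vec.span_mono[OF B(3)] spanE by (simp add: vec.span_span UNIV_eq_I top.extremum_unique)
  have "vec.dim E = CARD(4)"
    using vec.dim_span[of E] spanE vec_dim_card by metis
  then have cB: "card B = CARD(4)" using B(4) by simp
  then have "finite B" by (simp add: card_ge_0_finite)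
  then obtain b :: "4 \<Rightarrow> 'k^4" where b: "bij_betw b UNIV B"
    using finite_same_card_bij[of "UNIV :: 4 set" B] cB by auto
  then have rb: "range b = B" by (simp add: bij_betw_def)
  then have "\<forall>i. \<exists>\<nu>. \<nu>^5 = e \<and> A *v b i = \<nu> *s b i"
    using B(1) unfolding E_def by blast
  then obtain \<nu> where "\<And>i. \<nu> i ^ 5 = e \<and> A *v b i = \<nu> i *s b i" by metis
  then show ?thesis using rb spanB by blast
qed

section \<open>Normal form of a cubic with an automorphism of order five\<close>

lemma proj_equiv_cubic_S'_if_quintic_automorphism:
  fixes f :: "'k::{alg_closed_field, field_char_0} poly4"
  assumes f: "nonsingular_cubic f"
    and c: "c \<noteq> 0" "\<And>v. eval4 f v = c * eval4 f (A *v v)"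
    and e: "e \<noteq> 0" "\<And>v. A *v (A *v (A *v (A *v (A *v v)))) = e *s v"
    and nonscalar: "\<And>s. A \<noteq> mat s"
  shows "proj_equiv f cubic_S'"
proof -
  have hom: "homogeneous4 3 f" and ns: "nonsingular4 f"
    using f by (auto simp: nonsingular_cubic_def)
  obtain T where T: "symmetric_trilinear T" "\<And>v. T v v v = 6 * eval4 f v"
    "\<And>l v. T (axis l 1) v v = 2 * eval4 (pderiv4 l f) v"
    using polar_form_exists[OF hom] by blast
  interpret T: symmetric_trilinear T by (rule T(1))
  have nondeg: "\<exists>u. T u v v \<noteq> 0" if "v \<noteq> 0" for v
    using ns that unfolding nonsingular_iff_polar_form[OF T] by blast
  have "T (A *v v) (A *v v) (A *v v) = 1 / c * T v v v" for v
    using c(1) by (simp add: T(2) c(2)[of v])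
  then have TA: "T (A *v u) (A *v v) (A *v w) = 1 / c * T u v w" for u v w
    by (rule T.semi_invariant[where B = "\<lambda>v. A *v v", OF matrix_vector_right_distrib])
  obtain \<zeta> :: 'k where "clebsch \<zeta>" using clebsch_root_exists by blast
  obtain \<delta> where \<delta>: "\<delta>^5 = e" using nth_root_exists[of 5 e] by auto
  obtain b :: "4 \<Rightarrow> 'k^4" and \<nu> where span: "vec.span (range b) = UNIV" and b: "\<And>i. A *v b i = \<nu> i *s b i" and \<nu>: "\<And>i. \<nu> i ^ 5 = e"
    using clebsch.eigenbasis[OF \<open>clebsch \<zeta>\<close> e(1) \<delta> e(2)] by blast
  have weight: "c * \<nu> i * \<nu> j * \<nu> k = 1" if "T (b i) (b j) (b k) \<noteq> 0" for i j k
  proof -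
    let ?t = "T (b i) (b j) (b k)"
    have h: "\<nu> i * (\<nu> j * (\<nu> k * ?t)) = 1 / c * ?t"
      using TA[of "b i" "b j" "b k"] by (simp only: b T.scale_left T.scale_mid T.scale_right mult.left_commute)
    have "c * \<nu> i * \<nu> j * \<nu> k * ?t = c * (1 / c * ?t)"
      by (simp only: mult.assoc h)
    then have "c * \<nu> i * \<nu> j * \<nu> k * ?t = 1 * ?t" using c(1) by simp
    then show ?thesis unfolding mult_right_cancel[OF that] .
  qed
  have b0: "b i \<noteq> 0" for i
  proof
    assume "b i = 0"
    then have "(\<chi> i j. b j $ i) *v axis i 1 = 0"
      unfolding column_matrix_vector by (intro sum.neutral) (auto simp: axis_def)
    then have "axis i 1 = (0 :: 'k^4)"
      using matrix_inv_cancel(2)[OF invertible_column_matrix[OF span], of "axis i 1"] by simp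
    then show False by (simp add: axis_eq_0_iff)
  qed
  \<comment> \<open>Otherwise all partial derivatives would vanish at \<open>b i\<close>, and the
    surface would be singular there.\<close>
  have partner: "\<exists>j. T (b i) (b i) (b j) \<noteq> 0" for i
  proof (rule ccontr)
    assume h: "\<nexists>j. T (b i) (b i) (b j) \<noteq> 0"
    have "T u (b i) (b i) = 0" for u
    proof -
      obtain x where "u = (\<Sum>j\<in>UNIV. x j *s b j)" by (rule span_range_expand[OF span])
      moreover have "T (b j) (b i) (b i) = 0" for j using h T.swap12 T.swap23 by metis
      ultimately show ?thesis by (simp add: T.sum_left)
    qed
    then show False using nondeg[OF b0] by blast
  qed
  txt \<open>Rescaling the eigenvalues by \<open>c\<^sup>2 e\<close> turns them into fifth roots of unity and makes \<open>f\<close> invariant.\<close>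
  define \<kappa> where "\<kappa> i = \<nu> i * c^2 * e" for i
  \<comment> \<open>The weight relation of one nonzero coefficient, raised to the fifth
    power.\<close>
  have ce: "c^5 * e^3 = 1"
  proof -
    obtain j where "c * \<nu> 1 * \<nu> 1 * \<nu> j = 1" using partner[of 1] weight by blast
    then have "(c * \<nu> 1 * \<nu> 1 * \<nu> j)^5 = 1" by simp
    then show ?thesis by (simp add: power_mult_distrib \<nu> power3_eq_cube mult.assoc)
  qed
  have \<kappa>5: "\<kappa> i ^ 5 = 1" for i
  proof -
    have "\<kappa> i ^ 5 = \<nu> i ^ 5 * (c^10 * e^5)" by (simp add: \<kappa>_def power_mult_distrib power_mult[symmetric])
    also have "\<dots> = (c^5 * e^3)^2" unfolding \<nu> by (simp add: power_mult_distrib power_mult[symmetric] power_numeral_reduce)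
    finally show ?thesis by (simp add: ce)
  qed
  have \<kappa>w: "\<kappa> i * \<kappa> j * \<kappa> k = 1" if "T (b i) (b j) (b k) \<noteq> 0" for i j k
  proof -
    have "\<kappa> i * \<kappa> j * \<kappa> k = (c * \<nu> i * \<nu> j * \<nu> k) * (c^5 * e^3)"
      by (simp add: \<kappa>_def power_numeral_reduce algebra_simps)
    then show ?thesis by (simp add: weight[OF that] ce)
  qed
  have c2e: "c^2 * e \<noteq> 0" using c(1) e(1) by simp
  have "\<exists>i. \<kappa> i \<noteq> 1"
  proof (rule ccontr)
    assume "\<nexists>i. \<kappa> i \<noteq> 1"
    then have \<nu>1: "\<nu> i = 1 / (c^2 * e)" for i
      using c2e by (simp add: \<kappa>_def eq_divide_eq mult.assoc)
    have "A = mat (1 / (c^2 * e))"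
    proof (rule matrix_eq[THEN iffD2], intro allI)
      fix v
      obtain x where v: "v = (\<Sum>j\<in>UNIV. x j *s b j)" by (rule span_range_expand[OF span])
      show "A *v v = mat (1 / (c^2 * e)) *v v"
        unfolding v mat_mult_vector sum_4 matrix_vector_right_distrib vector_scalar_commute b \<nu>1
          vector_add_ldistrib vector_smult_assoc by (simp add: mult.commute)
    qed
    then show False using nonscalar by blast
  qed
  then obtain i0 where i0: "\<kappa> i0 \<noteq> 1" by blast
  define \<eta> where "\<eta> = \<kappa> i0"
  interpret clebsch \<eta> using clebsch_of_fifth_root[OF \<kappa>5 i0] by (simp add: \<eta>_def)
  have cube: "\<exists>j. T (b i) (b i) (b j) \<noteq> 0 \<and> \<kappa> j = \<kappa> i ^ 3" for i
  proof -
    obtain j where j: "T (b i) (b i) (b j) \<noteq> 0" using partner by blast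
    have "\<kappa> i ^ 3 = \<kappa> i ^ 3 * (\<kappa> i * \<kappa> i * \<kappa> j)" by (simp add: \<kappa>w[OF j])
    also have "\<dots> = \<kappa> i ^ 5 * \<kappa> j" by (simp add: power_numeral_reduce algebra_simps)
    finally show ?thesis using j by (auto simp: \<kappa>5)
  qed
  obtain i1 where i1: "\<kappa> i1 = \<eta>^3" using cube[of i0] by (auto simp: \<eta>_def)
  \<comment> \<open>Repeated cubing reaches all primitive roots because 3 generates the units modulo
    5: the exponents are 1, 3, 9 = 4 and 12 = 2.\<close>
  obtain i2 where i2: "\<kappa> i2 = \<eta>^4"
    using cube[of i1] zeta_mod[of 9] by (auto simp: i1 power_mult[symmetric])
  obtain i3 where i3: "\<kappa> i3 = \<eta>^2"
    using cube[of i2] zeta_mod[of 12] by (auto simp: i2 power_mult[symmetric])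
  define \<pi> :: "4 \<Rightarrow> 4" where "\<pi> a = (if a = 1 then i0 else if a = 2 then i1 else if a = 3 then i2 else i3)" for a
  have \<kappa>\<pi>: "\<kappa> (\<pi> a) = \<eta>^(wt a)" for a
    by (simp add: \<pi>_def wt_def i1 i2 i3 \<eta>_def[symmetric])
  have dvd: "5 dvd n" if "\<eta>^n = 1" for n
  proof (rule ccontr)
    assume "\<not> 5 dvd n"
    then have "\<eta>^n + \<eta>^(2*n) + \<eta>^(3*n) + \<eta>^(4*n) = - 1" by (simp add: zeta_sum4)
    moreover have "\<eta>^(k*n) = 1" for k using that by (metis mult.commute power_mult power_one)
    ultimately have "4 = (- 1 :: 'k)" using that by simp
    then show False by (simp add: eq_neg_iff_add_eq_0)
  qed
  define B where "B a = b (\<pi> a)" for a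
  have TB: "5 dvd wt a1 + wt a2 + wt a3" if "T (B a1) (B a2) (B a3) \<noteq> 0" for a1 a2 a3
    using \<kappa>w[OF that[unfolded B_def]] by (intro dvd) (simp add: \<kappa>\<pi> power_add)
  have "inj \<pi>"
  proof (rule injI)
    fix a1 a2 assume "\<pi> a1 = \<pi> a2"
    then have "\<eta>^(wt a1) = \<eta>^(wt a2)" using \<kappa>\<pi> by metis
    then have "\<eta>^(wt a1 + (5 - wt a2)) = \<eta>^(wt a2 + (5 - wt a2))" by (simp only: power_add)
    moreover have "wt a2 + (5 - wt a2) = 5" by (simp add: wt_def)
    ultimately have "5 dvd wt a1 + (5 - wt a2)" by (intro dvd) (simp only: zeta5)
    then show "a1 = a2"
      using exhaust_4[of a1] exhaust_4[of a2] by (elim disjE) (simp_all add: wt_simps del: One_nat_def)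
  qed
  then have "range \<pi> = UNIV" by (simp add: finite_UNIV_inj_surj)
  then have rangeB: "range B = range b" unfolding B_def by (metis image_image)
  have partnerB: "\<exists>a'. T (B a) (B a) (B a') \<noteq> 0" for a
    using partner[of "\<pi> a"] \<open>range \<pi> = UNIV\<close> unfolding B_def by (metis surj_def)
  have vanish: "T (B a1) (B a2) (B a3) = 0" if "\<not> 5 dvd wt a1 + wt a2 + wt a3" for a1 a2 a3
    using TB that by blast
  have TB0: "T (B 1) (B 1) (B 2) \<noteq> 0" "T (B 2) (B 2) (B 3) \<noteq> 0" "T (B 3) (B 3) (B 4) \<noteq> 0" "T (B 4) (B 4) (B 1) \<noteq> 0"
  proof -
    \<comment> \<open>For each \<open>a\<close> only one \<open>a'\<close> completes the weights to
      a multiple of 5, so the partner provided by nonsingularity is forced.\<close>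
    have *: "a' = a''" if "5 dvd wt a + wt a + wt a'" "5 dvd wt a + wt a + wt a''" for a a' a''
      using that exhaust_4[of a] exhaust_4[of a'] exhaust_4[of a'']
      by (elim disjE) (simp_all add: wt_simps del: One_nat_def)
    have **: "T (B a) (B a) (B a') \<noteq> 0" if "5 dvd wt a + wt a + wt a'" for a a'
      using partnerB[of a] TB * that by metis
    show "T (B 1) (B 1) (B 2) \<noteq> 0" "T (B 2) (B 2) (B 3) \<noteq> 0" "T (B 3) (B 3) (B 4) \<noteq> 0" "T (B 4) (B 4) (B 1) \<noteq> 0"
      by (rule **, simp add: wt_simps del: One_nat_def)+
  qed
  \<comment> \<open>Prescribed values of the products \<open>s1^2 * s2\<close> and so on; the polar
    form of \<open>x^2 * y\<close> takes the value 2 at the corresponding basis vectors.\<close>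
  define \<beta>1 \<beta>2 \<beta>3 \<beta>4 where "\<beta>1 = 2 / T (B 1) (B 1) (B 2)" and "\<beta>2 = 2 / T (B 2) (B 2) (B 3)"
    and "\<beta>3 = 2 / T (B 3) (B 3) (B 4)" and "\<beta>4 = 2 / T (B 4) (B 4) (B 1)"
  have \<beta>0: "\<beta>1 \<noteq> 0" "\<beta>2 \<noteq> 0" "\<beta>3 \<noteq> 0" "\<beta>4 \<noteq> 0"
    using TB0 by (simp_all add: \<beta>1_def \<beta>2_def \<beta>3_def \<beta>4_def)
  \<comment> \<open>Eliminating \<open>s2\<close>, \<open>s3\<close>, \<open>s4\<close> successively
    from the first three scaling equations turns the last one into this equation for
    \<open>s1\<close>, solvable over an algebraically closed field.\<close>
  obtain s1 where s1: "s1^15 = \<beta>3^2 * \<beta>1^8 / (\<beta>2^4 * \<beta>4)"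
    using nth_root_exists[of 15 "\<beta>3^2 * \<beta>1^8 / (\<beta>2^4 * \<beta>4)"] by auto
  have s10: "s1 \<noteq> 0" using s1 \<beta>0 by auto
  define s2 where "s2 = \<beta>1 / s1^2"
  define s3 where "s3 = \<beta>2 / s2^2"
  define s4 where "s4 = \<beta>3 / s3^2"
  have s0: "s2 \<noteq> 0" "s3 \<noteq> 0" "s4 \<noteq> 0" using s10 \<beta>0 by (simp_all add: s2_def s3_def s4_def)
  have eq1: "s1^2 * s2 = \<beta>1" and eq2: "s2^2 * s3 = \<beta>2" and eq3: "s3^2 * s4 = \<beta>3"
    using s10 s0 by (simp_all add: s2_def s3_def s4_def)
  have eq4: "s4^2 * s1 = \<beta>4"
  proof -
    have "s3 = \<beta>2 * s1^4 / \<beta>1^2"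
      by (simp add: s3_def s2_def power_divide power_mult[symmetric])
    then have "s4 = \<beta>3 * \<beta>1^4 / (\<beta>2^2 * s1^8)"
      by (simp add: s4_def power_divide power_mult_distrib power_mult[symmetric])
    then have "s4^2 * s1 = \<beta>3^2 * \<beta>1^8 / (\<beta>2^4 * s1^16) * s1"
      by (simp add: power_divide power_mult_distrib power_mult[symmetric])
    also have "s1^16 = s1^15 * s1" by (simp add: power_numeral_reduce)
    also have "\<beta>3^2 * \<beta>1^8 / (\<beta>2^4 * (s1^15 * s1)) * s1 = \<beta>3^2 * \<beta>1^8 / (\<beta>2^4 * s1^15)"
      using s10 by simp
    also have "\<dots> = \<beta>4" unfolding s1 using \<beta>0 by simp
    finally show ?thesis .
  qed
  define s :: "4 \<Rightarrow> 'k" where "s a = (if a = 1 then s1 else if a = 2 then s2 else if a = 3 then s3 else s4)" for a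
  have s: "s 1 = s1" "s 2 = s2" "s 3 = s3" "s 4 = s4" by (simp_all add: s_def)
  have sn0: "s a \<noteq> 0" for a using s10 s0 by (simp add: s_def)
  define D where "D a = s a *s B a" for a
  have TD: "T (D a1) (D a2) (D a3) = s a1 * s a2 * s a3 * T (B a1) (B a2) (B a3)" for a1 a2 a3
    by (simp add: D_def T.scale_left T.scale_mid T.scale_right)
  have "range B \<subseteq> vec.span (range D)"
  proof safe
    fix a
    have "B a = (1 / s a) *s D a" using sn0 by (simp add: D_def vector_smult_assoc)
    then show "B a \<in> vec.span (range D)" by (simp add: vec.span_scale vec.span_base)
  qed
  then have "vec.span (range B) \<subseteq> vec.span (range D)" by (rule vec.span_minimal) (rule vec.subspace_span)
  then have spanD: "vec.span (range D) = UNIV" using span rangeB by auto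
  define Q where "Q = (\<chi> i j. D j $ i)"
  have Qinv: "invertible Q" unfolding Q_def by (rule invertible_column_matrix[OF spanD])
  have vanishD: "T (D a1) (D a2) (D a3) = 0" if "\<not> 5 dvd wt a1 + wt a2 + wt a3" for a1 a2 a3
    using vanish[OF that] by (simp add: TD)
  have val: "T (D 1) (D 1) (D 2) = 2" "T (D 2) (D 2) (D 3) = 2" "T (D 3) (D 3) (D 4) = 2" "T (D 4) (D 4) (D 1) = 2"
  proof -
    have "s1 * s1 * s2 = \<beta>1" "s2 * s2 * s3 = \<beta>2" "s3 * s3 * s4 = \<beta>3" "s4 * s4 * s1 = \<beta>4"
      using eq1 eq2 eq3 eq4 by (simp_all add: power2_eq_square)
    then show "T (D 1) (D 1) (D 2) = 2" "T (D 2) (D 2) (D 3) = 2" "T (D 3) (D 3) (D 4) = 2" "T (D 4) (D 4) (D 1) = 2"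
      unfolding TD s using TB0 by (simp_all add: \<beta>1_def \<beta>2_def \<beta>3_def \<beta>4_def)
  qed
  have sym: "T (D 1) (D 2) (D 1) = 2" "T (D 2) (D 1) (D 1) = 2" "T (D 2) (D 3) (D 2) = 2" "T (D 3) (D 2) (D 2) = 2"
     "T (D 3) (D 4) (D 3) = 2" "T (D 4) (D 3) (D 3) = 2" "T (D 4) (D 1) (D 4) = 2" "T (D 1) (D 4) (D 4) = 2"
    using val T.swap12 T.swap23 by metis+
  have evalQ: "eval4 f (Q *v v) = eval4 cubic_S' v" for v
  proof -
    have "T (Q *v v) (Q *v v) (Q *v v) = (\<Sum>i\<in>UNIV. v $ i * (\<Sum>j\<in>UNIV. v $ j * (\<Sum>k\<in>UNIV. v $ k * T (D k) (D j) (D i))))"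
      unfolding Q_def column_matrix_vector T.sum_left T.sum_mid T.sum_right ..
    also have "\<dots> = 6 * eval4 cubic_S' v"
      unfolding sum_4 eval4_cubic_S'
      by (simp add: val sym vanishD wt_simps power2_eq_square algebra_simps del: One_nat_def)
    finally show ?thesis by (simp add: T(2))
  qed
  \<comment> \<open>The action substitutes the inverse matrix, so the required transformation is the
    inverse of \<open>Q\<close>.\<close>
  let ?R = "matrix_inv Q"
  have Rinv: "invertible ?R"
    using Qinv matrix_inv_cancel[OF Qinv]
    by (metis invertible_left_inverse matrix_eq matrix_vector_mul_assoc matrix_vector_mul_lid)
  have "matrix_inv ?R *v v = Q *v v" for v
    using matrix_inv_cancel(2)[OF Rinv, of "Q *v v"] by (simp add: matrix_inv_cancel[OF Qinv])
  then have "cubic_S' = Const4 1 * act4 ?R f"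
    by (intro eval4_inject) (simp add: eval4_mult eval4_act4 evalQ)
  then have "cubic_S' \<sim>\<^sub>4 act4 ?R f"
    unfolding sim4_def by (intro exI[of _ 1]) simp
  then show ?thesis using Rinv unfolding proj_equiv_def by (auto simp: GL4_def)
qed

section \<open>Lifting a five-cycle to a matrix\<close>

lemma sym_group_5_cycle:
  obtains p where "p \<in> carrier (sym_group 5)" "p \<noteq> id" "p \<circ> (p \<circ> (p \<circ> (p \<circ> p))) = id"
proof -
  define p :: "nat \<Rightarrow> nat" where "p x = (if x \<in> {1,2,3,4} then x + 1 else if x = 5 then 1 else x)" for x
  have 5: "p \<circ> (p \<circ> (p \<circ> (p \<circ> p))) = id" by (auto simp: p_def fun_eq_iff)
  have "p permutes {1..5}"
  proof -
    \<comment> \<open>The fourth power of the cycle is its inverse.\<close>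
    have "bij p"
      by (rule o_bij[of "p \<circ> (p \<circ> (p \<circ> p))"]) (use 5 in \<open>simp_all add: o_assoc\<close>)
    then show ?thesis
      by (auto simp: permutes_def bij_iff) (auto simp: p_def)
  qed
  moreover have "p \<noteq> id" by (auto simp: p_def fun_eq_iff intro!: exI[of _ 1])
  ultimately show ?thesis using 5 that by (simp add: sym_group_carrier)
qed

text \<open>A five-cycle is pulled back along the isomorphism. Its fifth power is trivial, so that
  of a representing matrix is scalar; the matrix itself is not, since the cycle is not the
  identity.\<close>

lemma quintic_automorphism_exists:
  fixes f :: "'k::field_char_0 poly4"
  assumes "Aut f \<cong> sym_group 5"
  shows "\<exists>c A e. c \<noteq> 0 \<and> (\<forall>v. eval4 f v = c * eval4 f (A *v v)) \<and> e \<noteq> 0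
    \<and> (\<forall>v. A *v (A *v (A *v (A *v (A *v v)))) = e *s v) \<and> (\<forall>s. A \<noteq> mat s)"
proof -
  obtain h where h: "h \<in> iso (Aut f) (sym_group 5)"
    using assms by (auto simp: is_iso_def)
  then have hmult: "h (X \<otimes>\<^bsub>PGL4\<^esub> Y) = h X \<circ> h Y" if "X \<in> carrier (Aut f)" "Y \<in> carrier (Aut f)" for X Y
    using that by (auto simp: iso_def hom_def mult_Aut sym_group_mult)
  have bij: "bij_betw h (carrier (Aut f)) (carrier (sym_group 5))" using h by (simp add: iso_def)
  define G where "G = {A. invertible A \<and> (\<exists>c. c \<noteq> 0 \<and> (\<forall>v. eval4 f v = c * eval4 f (A *v v)))}"
  have Aut: "carrier (Aut f) = PGL_class ` G"
    unfolding carrier_Aut G_def by auto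
  have G_inv: "invertible A" if "A \<in> G" for A using that by (simp add: G_def)
  have G_mult: "A ** B \<in> G" if "A \<in> G" "B \<in> G" for A B
  proof -
    obtain c d where c: "c \<noteq> 0" "\<And>v. eval4 f v = c * eval4 f (A *v v)" and d: "d \<noteq> 0" "\<And>v. eval4 f v = d * eval4 f (B *v v)"
      using \<open>A \<in> G\<close> \<open>B \<in> G\<close> unfolding G_def by blast
    have "eval4 f v = (d * c) * eval4 f ((A ** B) *v v)" for v
    proof -
      have "eval4 f v = d * eval4 f (B *v v)" by (rule d(2))
      also have "eval4 f (B *v v) = c * eval4 f (A *v (B *v v))" by (rule c(2))
      finally show ?thesis by (simp add: matrix_vector_mul_assoc)
    qed
    moreover have "d * c \<noteq> 0" using c(1) d(1) by simp
    moreover have "invertible (A ** B)" using invertible_mult G_inv that by blast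
    ultimately show ?thesis unfolding G_def by blast
  qed
  have G1: "mat 1 \<in> G"
  proof -
    have "invertible (mat 1 :: 'k^4^4)" by (auto simp: invertible_def intro!: exI[of _ "mat 1"])
    moreover have "(1 :: 'k) \<noteq> 0 \<and> (\<forall>v. eval4 f v = 1 * eval4 f (mat 1 *v v))" by simp
    ultimately show ?thesis unfolding G_def by blast
  qed
  have hG: "h (PGL_class (A ** B)) = h (PGL_class A) \<circ> h (PGL_class B)" if "A \<in> G" "B \<in> G" for A B
    using hmult[of "PGL_class A" "PGL_class B"] that by (simp add: Aut PGL_class_mult G_inv)
  \<comment> \<open>The image of the unit class is an idempotent injective map, hence the
    identity.\<close>
  have h1: "h (PGL_class (mat 1)) = id"
  proof -
    let ?q = "h (PGL_class (mat 1))"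
    have "?q permutes {1..5}"
      using bij_betwE[OF bij] G1 by (simp add: Aut sym_group_carrier)
    then have "inj ?q" by (rule permutes_inj)
    moreover have "?q (?q x) = ?q x" for x using hG[OF G1 G1] by (simp add: fun_eq_iff)
    ultimately show ?thesis by (auto simp: fun_eq_iff dest: injD)
  qed
  obtain p where p: "p \<in> carrier (sym_group 5)" "p \<noteq> id" "p \<circ> (p \<circ> (p \<circ> (p \<circ> p))) = id"
    by (rule sym_group_5_cycle)
  have "p \<in> h ` (PGL_class ` G)"
    using p(1) bij by (simp add: bij_betw_def Aut)
  then obtain A where A: "A \<in> G" "h (PGL_class A) = p" by blast
  let ?A5 = "A ** (A ** (A ** (A ** A)))"
  have "h (PGL_class ?A5) = h (PGL_class (mat 1))"
    by (simp add: hG G_mult A h1 p(3))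
  moreover have "PGL_class ?A5 \<in> carrier (Aut f)" "PGL_class (mat 1) \<in> carrier (Aut f)"
    unfolding Aut by (intro imageI G_mult A(1) G1)+
  ultimately have "PGL_class ?A5 = PGL_class (mat 1)"
    by (rule inj_onD[OF bij_betw_imp_inj_on[OF bij]])
  then obtain e where e: "e \<noteq> 0" "?A5 = mat e"
    by (auto simp: PGL_class_eq_iff)
  have "A *v (A *v (A *v (A *v (A *v v)))) = e *s v" for v
    using e(2) by (simp add: matrix_vector_mul_assoc mat_mult_vector[symmetric] matrix_mul_assoc)
  moreover have "A \<noteq> mat s" for s
  proof
    assume s: "A = mat s"
    have "s \<noteq> 0"
    proof
      assume "s = 0"
      then have "A *v axis 1 1 = 0" by (simp add: s mat_mult_vector)
      then have "axis 1 1 = (0 :: 'k^4)"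
        using matrix_inv_cancel(2)[OF G_inv[OF A(1)], of "axis 1 1"] by simp
      then show False by (simp add: axis_eq_0_iff)
    qed
    then have "PGL_class A = PGL_class (mat 1)" using s by (auto simp: PGL_class_eq_iff)
    then show False using A(2) h1 p(2) by simp
  qed
  moreover obtain c where "c \<noteq> 0" "\<And>v. eval4 f v = c * eval4 f (A *v v)"
    using A(1) unfolding G_def by blast
  ultimately show ?thesis using e(1) by blast
qed

theorem mainTheorem2:
  shows "nonsingular_cubic (cubic_S' :: 'k::{alg_closed_field, field_char_0} poly4)
       \<and> Aut (cubic_S' :: 'k poly4) \<cong> sym_group 5
       \<and> (\<forall>f :: 'k poly4. nonsingular_cubic f \<and> Aut f \<cong> sym_group 5 \<longrightarrow> proj_equiv f cubic_S')"
proof -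
  \<comment> \<open>A primitive fifth root of unity makes the results on the Clebsch form available
    for the first two claims.\<close>
  obtain \<zeta> :: 'k where "clebsch \<zeta>" using clebsch_root_exists by blast
  have "proj_equiv f cubic_S'" if f: "nonsingular_cubic f" "Aut f \<cong> sym_group 5" for f :: "'k poly4"
  proof -
    obtain c A e where "c \<noteq> 0" "\<And>v. eval4 f v = c * eval4 f (A *v v)" "e \<noteq> 0"
      "\<And>v. A *v (A *v (A *v (A *v (A *v v)))) = e *s v" "\<And>s. A \<noteq> mat s"
      using quintic_automorphism_exists[OF f(2)] by blast
    then show ?thesis by (rule proj_equiv_cubic_S'_if_quintic_automorphism[OF f(1)])
  qed
  then show ?thesis
    using clebsch.nonsingular_cubic_S'[OF \<open>clebsch \<zeta>\<close>] clebsch.Aut_cubic_S'_iso[OF \<open>clebsch \<zeta>\<close>] by blast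
qed

end
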